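(* Let $B^{(n)}$, $Q^{(n)}$, $J$ be associated with $(\mu,\vec w,\vec n)$ as in the context. Assume that $J$ is nonnegative; that $b(B)<\infty$, $b(B)\notin\mathscr Z(B)$; that $b(Q)<\infty$, $b(Q)\notin\mathscr Z(Q)$; and that $\lim_{x\to+\infty}Q^{(n)}(x)=+\infty$ (for $n\in\mathbb N_0$). Let $\lambda\ge\max(b(B),b(Q))$, and let $P_{II}=\frac1\lambda\sigma_{II}J\sigma_{II}^{-1}$, $P_I=\frac1\lambda\sigma_IJ^\top\sigma_I^{-1}$ with $\sigma_{II}=\operatorname{diag}(1/B^{(n)}(\lambda))_{n\ge0}$, $\sigma_I=\operatorname{diag}(1/Q^{(n)}(\lambda))_{n\ge0}$. Then: (i) The row vector $\boldsymbol\kappa_\lambda=\big(B^{(0)}(\lambda)Q^{(0)}(\lambda),B^{(1)}(\lambda)Q^{(1)}(\lambda),\dots\big)$ is a nonnegative vector, which is a left eigenvector with eigenvalue $1$ of both dual multiple stochastic matrices: $\boldsymbol\kappa_\lambda P_{II}=\boldsymbol\kappa_\lambda$ and $\boldsymbol\kappa_\lambda P_I=\boldsymbol\kappa_\lambda$. (ii) If $\boldsymbol\kappa_\lambda\in\ell_1$, i.e. $\|\boldsymbol\kappa_\lambda\|_1=\sum_{k=0}^\infty B^{(k)}(\lambda)Q^{(k)}(\lambda)<\infty$, then $\boldsymbol\pi_\lambda=\boldsymbol\kappa_\lambda/\|\boldsymbol\kappa_\lambda\|_1$ is a steady state for both dual Markov chains. In this situation the random walk is positive recurrent, and whenever the chain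 is aperiodic it is also ergodic. (iii) If $$\lim_{n\to\infty}\frac{B^{(n+1)}(\lambda)Q^{(n+1)}(\lambda)}{B^{(n)}(\lambda)Q^{(n)}(\lambda)}<1,$$ then $\boldsymbol\kappa_\lambda\in\ell_1$ and $\boldsymbol\pi_\lambda=\boldsymbol\kappa_\lambda/\|\boldsymbol\kappa_\lambda\|_1$ is a steady state.
   Context: General setting. $\Delta\subset\mathbb R$ is an interval, $\mu$ is a finite Borel measure on $\Delta$ that does not change sign and whose support has infinitely many points, $w_1,\dots,w_p$ are weights on $\Delta$ (real integrable functions that do not change sign on $\Delta$), and $\vec n=(n_1,\dots,n_p)$ is a vector of positive integers, $|\vec n|=n_1+\dots+n_p$. Every $i\in\mathbb N_0$ is written uniquely as $i=q(i)|\vec n|+n_1+\dots+n_{a(i)-1}+r(i)$ with $q(i)\in\mathbb N_0$, $a(i)\in\{1,\dots,p\}$, $0\le r(i)<n_{a(i)}$; put $k(i)=q(i)n_{a(i)}+r(i)$ and $\xi^{(i)}(x)=x^{k(i)}w_{a(i)}(x)$. The pair $(\mu,\vec w)$ is assumed perfect; in particular all leading principal minors of the moment matrix $g_{i,j}=\int_\Delta x^i\xi^{(j)}(x)\,d\mu(x)$ are nonzero. Then: - $B^{(l)}$ is the unique monic polynomial of degree $l$ with $\int_\Delta B^{(l)}\xi^{(j)}\,d\mu=0$ for $0\le j<l$ (type II multiple orthogonal polynomial); - $Q^{(l)}(x)=\sum_{a=1}^pA^{(l)}_a(x) w_a(x)$, with polynomials $A^{(l)}_a$, is the unique real linear combination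 of $\xi^{(0)},\dots,\xi^{(l)}$ with $\int_\Delta x^iQ^{(l)}(x)\,d\mu(x)=\delta_{i,l}$ for $0\le i\le l$ (type I linear form); the same expression gives its value at points $x$ outside $\Delta$; - the Jacobi matrix $J=(J_{n,m})_{n,m\in\mathbb N_0}$ is defined by $xB^{(n)}(x)=\sum_m J_{n,m}B^{(m)}(x)$. With $N:=\max_a(|\vec n|-n_a+1)$ one has $J_{n,n+1}=1$ and $J_{n,m}=0$ unless $n-N\le m\le n+1$; moreover $J^\top Q(x)=xQ(x)$ for $Q=(Q^{(0)},Q^{(1)},\dots)^\top$. $\mathscr Z(B)\subset\mathbb C$ (resp. $\mathscr Z(Q)\subset\mathbb C$) is the union over $n\in\mathbb N_0$ of the sets of zeros of $B^{(n)}$ (resp. $Q^{(n)}$), and $b(B)$, $b(Q)$ are the suprema of the absolute values of their elements. Under the assumptions $P_{II}$ and $P_I$ are stochastic matrices (nonnegative entries, rows summing to $1$), called dual; the associated Markov chains on $\mathbb N_0$ are the dual Markov chains (random walks). A steady state of a chain with stochastic matrix $P$ is a row vector $\boldsymbol\pi$ with nonnegative entries summing to $1$ and $\boldsymbol\pi P=\boldsymbol\pi$. A chain is positive recurrent if every state is recurrent with finite expected return time, and ergodic if it is positive recurrent and aperiodic.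
   Formalization: The weights are additionally assumed to be defined, real and continuous on the ray [b(Q),∞); without continuity, changing the sign of the weights at the single point λ outside Δ makes κ_λ negative, so (i) fails as stated. *)

theory Defs
  imports "HOL-Probability.Probability" "HOL-Computational_Algebra.Polynomial"
begin

section \<open>Measure and weights\<close>

text \<open>
  A Borel measure on \<open>\<Delta>\<close> of constant sign is a pair \<open>(M, s)\<close>: the positive measure \<open>M\<close> is its
  total variation, \<open>s \<in> {1, -1}\<close> its sign.
\<close>

definition meas_support :: "real set \<Rightarrow> real measure \<Rightarrow> real set" where
  "meas_support \<Delta> M = {x \<in> \<Delta>. \<forall>U. open U \<longrightarrow> x \<in> U \<longrightarrow> emeasure M (U \<inter> \<Delta>) > 0}"

definition measure_on :: "real set \<Rightarrow> real measure \<Rightarrow> real \<Rightarrow> bool" where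
  "measure_on \<Delta> M s \<longleftrightarrow>
     is_interval \<Delta> \<and> sets M = sets (restrict_space borel \<Delta>) \<and> finite_measure M \<and>
     infinite (meas_support \<Delta> M) \<and> (s = 1 \<or> s = -1)"

definition mint :: "real measure \<Rightarrow> real \<Rightarrow> (real \<Rightarrow> real) \<Rightarrow> real" where
  "mint M s f = s * (LINT x|M. f x)"

text \<open>
  The weights are expressions \<open>w a\<close>, \<open>a \<in> {1..p}\<close>, in a complex variable whose domain of definition
  is \<open>D\<close>; the values of \<open>w a\<close> outside \<open>D\<close> are irrelevant. They are real on \<open>\<Delta>\<close>, and \<open>rw w a\<close> is the
  corresponding function of a real variable. All integrals \<open>\<integral> x^i w\<^sub>a d\<mu>\<close> have to exist for the moment
  matrix to be defined. That the expressions are defined, real and continuous on the real ray starting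
  at the bound of the zeros of the linear forms is a separate hypothesis, since the ray depends on
  these zeros; it gives sense to the values of the linear forms there, and to their sign.
\<close>

definition rw :: "(nat \<Rightarrow> complex \<Rightarrow> complex) \<Rightarrow> nat \<Rightarrow> real \<Rightarrow> real" where
  "rw w a x = Re (w a (complex_of_real x))"

definition weights_on ::
  "real set \<Rightarrow> real measure \<Rightarrow> nat \<Rightarrow> (nat \<Rightarrow> complex \<Rightarrow> complex) \<Rightarrow> complex set \<Rightarrow> bool" where
  "weights_on \<Delta> M p w D \<longleftrightarrow>
     complex_of_real ` \<Delta> \<subseteq> D \<and>
     (\<forall>a\<in>{1..p}.
        (\<forall>x\<in>\<Delta>. w a (complex_of_real x) \<in> \<real>) \<and>
        ((\<forall>x\<in>\<Delta>. rw w a x \<ge> 0) \<or> (\<forall>x\<in>\<Delta>. rw w a x \<le> 0)) \<and>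
        (\<forall>i. integrable M (\<lambda>x. x ^ i * rw w a x)))"

text \<open>
  Perfectness: every multi-index \<open>\<nu>\<close> (zero components allowed) is normal for type II and for type I.
  The condition \<open>deg A\<^sub>a \<le> \<nu>\<^sub>a - 1\<close> means \<open>A\<^sub>a = 0\<close> if \<open>\<nu>\<^sub>a = 0\<close>.
\<close>

definition normal_typeII ::
  "real measure \<Rightarrow> real \<Rightarrow> nat \<Rightarrow> (nat \<Rightarrow> complex \<Rightarrow> complex) \<Rightarrow> (nat \<Rightarrow> nat) \<Rightarrow> bool" where
  "normal_typeII M s p w \<nu> \<longleftrightarrow>
     (\<forall>B::real poly.
        B \<noteq> 0 \<longrightarrow> degree B \<le> (\<Sum>a=1..p. \<nu> a) \<longrightarrow>
        (\<forall>a\<in>{1..p}. \<forall>j<\<nu> a. mint M s (\<lambda>x. poly B x * (x ^ j * rw w a x)) = 0) \<longrightarrow>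
        degree B = (\<Sum>a=1..p. \<nu> a))"

definition normal_typeI ::
  "real measure \<Rightarrow> real \<Rightarrow> nat \<Rightarrow> (nat \<Rightarrow> complex \<Rightarrow> complex) \<Rightarrow> (nat \<Rightarrow> nat) \<Rightarrow> bool" where
  "normal_typeI M s p w \<nu> \<longleftrightarrow>
     (\<forall>A::nat \<Rightarrow> real poly.
        (\<exists>a\<in>{1..p}. A a \<noteq> 0) \<longrightarrow>
        (\<forall>a\<in>{1..p}. A a = 0 \<or> degree (A a) < \<nu> a) \<longrightarrow>
        (\<forall>j. j + 1 < (\<Sum>a=1..p. \<nu> a) \<longrightarrow>
             mint M s (\<lambda>x. x ^ j * (\<Sum>a=1..p. poly (A a) x * rw w a x)) = 0) \<longrightarrow>
        (\<forall>a\<in>{1..p}. \<nu> a > 0 \<longrightarrow> A a \<noteq> 0 \<and> degree (A a) = \<nu> a - 1))"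

definition perfect ::
  "real measure \<Rightarrow> real \<Rightarrow> nat \<Rightarrow> (nat \<Rightarrow> complex \<Rightarrow> complex) \<Rightarrow> bool" where
  "perfect M s p w \<longleftrightarrow> (\<forall>\<nu>. normal_typeII M s p w \<nu> \<and> normal_typeI M s p w \<nu>)"


section \<open>The staircase indexing\<close>

definition size_n :: "nat \<Rightarrow> (nat \<Rightarrow> nat) \<Rightarrow> nat" where
  "size_n p nv = (\<Sum>a=1..p. nv a)"

definition qidx :: "nat \<Rightarrow> (nat \<Rightarrow> nat) \<Rightarrow> nat \<Rightarrow> nat" where
  "qidx p nv i = i div size_n p nv"

definition aidx :: "nat \<Rightarrow> (nat \<Rightarrow> nat) \<Rightarrow> nat \<Rightarrow> nat" where
  "aidx p nv i = (LEAST a. i mod size_n p nv < (\<Sum>b=1..a. nv b))"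

definition ridx :: "nat \<Rightarrow> (nat \<Rightarrow> nat) \<Rightarrow> nat \<Rightarrow> nat" where
  "ridx p nv i = i mod size_n p nv - (\<Sum>b=1..<aidx p nv i. nv b)"

definition kidx :: "nat \<Rightarrow> (nat \<Rightarrow> nat) \<Rightarrow> nat \<Rightarrow> nat" where
  "kidx p nv i = qidx p nv i * nv (aidx p nv i) + ridx p nv i"

lemma idx_unique:
  assumes a: "a \<in> {1..p}" and r: "r < nv a"
    and i: "i = q * size_n p nv + (\<Sum>b=1..<a. nv b) + r"
  shows "qidx p nv i = q" "aidx p nv i = a" "ridx p nv i = r"
proof -
  let ?S = "\<lambda>a. \<Sum>b=1..<a. nv b"
  have S1: "(\<Sum>b=1..a. nv b) = ?S a + nv a"
    using a by (cases a) (auto simp: atLeastLessThanSuc_atLeastAtMost)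
  have "(\<Sum>b=1..a. nv b) \<le> size_n p nv"
    unfolding size_n_def using a by (intro sum_mono2) auto
  then have lt: "?S a + r < size_n p nv" using S1 r by linarith
  have m: "i mod size_n p nv = ?S a + r"
    using lt unfolding i by (simp add: add.assoc)
  show "qidx p nv i = q"
    using lt unfolding qidx_def i by (simp add: add.assoc)
  show A: "aidx p nv i = a"
    unfolding aidx_def m
  proof (rule Least_equality)
    show "?S a + r < (\<Sum>b=1..a. nv b)" using S1 r by simp
    fix c assume c: "?S a + r < (\<Sum>b=1..c. nv b)"
    show "a \<le> c"
    proof (rule ccontr)
      assume "\<not> a \<le> c"
      then have "(\<Sum>b=1..c. nv b) \<le> ?S a" by (intro sum_mono2) auto
      with c show False by simp
    qed
  qed
  show "ridx p nv i = r" unfolding ridx_def A m by simp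
qed

lemma idx_decomp:
  assumes "p \<ge> 1" and pos: "\<And>a. a \<in> {1..p} \<Longrightarrow> nv a > 0"
  shows "i = qidx p nv i * size_n p nv + (\<Sum>b=1..<aidx p nv i. nv b) + ridx p nv i"
    and "aidx p nv i \<in> {1..p}" and "ridx p nv i < nv (aidx p nv i)"
proof -
  let ?T = "\<lambda>a. \<Sum>b=1..a. nv b" and ?m = "i mod size_n p nv" and ?a = "aidx p nv i"
  have "nv 1 \<le> size_n p nv"
    unfolding size_n_def using assms(1) by (intro member_le_sum) auto
  then have "size_n p nv > 0" using pos[of 1] assms(1) by simp
  then have P: "?m < ?T p" unfolding size_n_def[symmetric] by simp
  have L: "?m < ?T ?a" unfolding aidx_def by (rule LeastI, rule P)
  have le: "?a \<le> p" unfolding aidx_def by (rule Least_le, rule P)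
  have "?a \<noteq> 0" using L by (auto intro: ccontr)
  then obtain c where c: "?a = Suc c" by (cases ?a) auto
  have "\<not> ?m < ?T c"
    using not_less_Least[of c "\<lambda>a. ?m < ?T a"] c unfolding aidx_def by simp
  then have ge: "(\<Sum>b=1..<?a. nv b) \<le> ?m"
    by (simp add: c atLeastLessThanSuc_atLeastAtMost)
  have T: "?T ?a = (\<Sum>b=1..<?a. nv b) + nv ?a"
    by (simp add: c atLeastLessThanSuc_atLeastAtMost)
  show "?a \<in> {1..p}" using le c by simp
  show "ridx p nv i < nv ?a" using L ge T unfolding ridx_def by linarith
  show "i = qidx p nv i * size_n p nv + (\<Sum>b=1..<?a. nv b) + ridx p nv i"
    using ge div_mult_mod_eq[of i "size_n p nv"] unfolding qidx_def ridx_def by linarith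
qed

definition xi :: "nat \<Rightarrow> (nat \<Rightarrow> complex \<Rightarrow> complex) \<Rightarrow> (nat \<Rightarrow> nat) \<Rightarrow> nat \<Rightarrow> real \<Rightarrow> real" where
  "xi p w nv j x = x ^ kidx p nv j * rw w (aidx p nv j) x"


section \<open>Multiple orthogonal polynomials, linear forms, Jacobi matrix\<close>

definition typeII_mops ::
  "real measure \<Rightarrow> real \<Rightarrow> nat \<Rightarrow> (nat \<Rightarrow> complex \<Rightarrow> complex) \<Rightarrow> (nat \<Rightarrow> nat) \<Rightarrow>
   (nat \<Rightarrow> real poly) \<Rightarrow> bool" where
  "typeII_mops M s p w nv B \<longleftrightarrow>
     (\<forall>l. degree (B l) = l \<and> lead_coeff (B l) = 1 \<and>
          (\<forall>j<l. mint M s (\<lambda>x. poly (B l) x * xi p w nv j x) = 0))"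

text \<open>The linear form with coefficient polynomials \<open>A\<close>, as a function on the domain of the weights.\<close>

definition linform ::
  "nat \<Rightarrow> (nat \<Rightarrow> complex \<Rightarrow> complex) \<Rightarrow> (nat \<Rightarrow> real poly) \<Rightarrow> complex \<Rightarrow> complex" where
  "linform p w A z = (\<Sum>a=1..p. poly (map_poly complex_of_real (A a)) z * w a z)"

definition rlinform ::
  "nat \<Rightarrow> (nat \<Rightarrow> complex \<Rightarrow> complex) \<Rightarrow> (nat \<Rightarrow> real poly) \<Rightarrow> real \<Rightarrow> real" where
  "rlinform p w A x = Re (linform p w A (complex_of_real x))"

text \<open>
  The first condition says that the linear form of \<open>A l\<close> is the linear combination
  \<open>\<Sum>j\<le>l. c j * \<xi>\<^sup>(\<^sup>j\<^sup>)\<close>, sorted by weights.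
\<close>

definition typeI_mops ::
  "real measure \<Rightarrow> real \<Rightarrow> nat \<Rightarrow> (nat \<Rightarrow> complex \<Rightarrow> complex) \<Rightarrow> (nat \<Rightarrow> nat) \<Rightarrow>
   (nat \<Rightarrow> nat \<Rightarrow> real poly) \<Rightarrow> bool" where
  "typeI_mops M s p w nv A \<longleftrightarrow>
     (\<forall>l. (\<exists>c::nat \<Rightarrow> real. \<forall>a\<in>{1..p}.
             A l a = (\<Sum>j | j \<le> l \<and> aidx p nv j = a. monom (c j) (kidx p nv j))) \<and>
          (\<forall>i\<le>l. mint M s (\<lambda>x. x ^ i * rlinform p w (A l) x) = (if i = l then 1 else 0)))"

definition jacobi_matrix :: "(nat \<Rightarrow> real poly) \<Rightarrow> (nat \<Rightarrow> nat \<Rightarrow> real) \<Rightarrow> bool" where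
  "jacobi_matrix B J \<longleftrightarrow>
     (\<forall>n. finite {m. J n m \<noteq> 0} \<and>
          [:0, 1:] * B n = (\<Sum>m | J n m \<noteq> 0. smult (J n m) (B m)))"

definition zeros_B :: "(nat \<Rightarrow> real poly) \<Rightarrow> complex set" where
  "zeros_B B = (\<Union>n. {z. poly (map_poly complex_of_real (B n)) z = 0})"

definition zeros_Q ::
  "nat \<Rightarrow> (nat \<Rightarrow> complex \<Rightarrow> complex) \<Rightarrow> complex set \<Rightarrow> (nat \<Rightarrow> nat \<Rightarrow> real poly) \<Rightarrow> complex set" where
  "zeros_Q p w D A = (\<Union>n. {z \<in> D. linform p w (A n) z = 0})"

definition zero_bound :: "complex set \<Rightarrow> ennreal" where
  "zero_bound Z = (SUP z\<in>Z. ennreal (norm z))"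


section \<open>Stochastic matrices and steady states\<close>

definition stochastic :: "(nat \<Rightarrow> nat \<Rightarrow> real) \<Rightarrow> bool" where
  "stochastic P \<longleftrightarrow> (\<forall>n m. 0 \<le> P n m) \<and> (\<forall>n. (\<lambda>m. P n m) sums 1)"

definition left_eigenvector :: "(nat \<Rightarrow> real) \<Rightarrow> (nat \<Rightarrow> nat \<Rightarrow> real) \<Rightarrow> real \<Rightarrow> bool" where
  "left_eigenvector v P c \<longleftrightarrow>
     (\<exists>n. v n \<noteq> 0) \<and> (\<forall>m. (\<lambda>n. v n * P n m) sums (c * v m))"

definition steady_state :: "(nat \<Rightarrow> real) \<Rightarrow> (nat \<Rightarrow> nat \<Rightarrow> real) \<Rightarrow> bool" where
  "steady_state v P \<longleftrightarrow>
     (\<forall>n. 0 \<le> v n) \<and> v sums 1 \<and> (\<forall>m. (\<lambda>n. v n * P n m) sums v m)"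

text \<open>\<open>diag \<sigma> T diag \<sigma>\<^sup>-\<^sup>1\<close>\<close>

definition diag_conj :: "(nat \<Rightarrow> real) \<Rightarrow> (nat \<Rightarrow> nat \<Rightarrow> real) \<Rightarrow> nat \<Rightarrow> nat \<Rightarrow> real" where
  "diag_conj \<sigma> T n m = \<sigma> n * T n m * inverse (\<sigma> m)"

definition P_II :: "(nat \<Rightarrow> real poly) \<Rightarrow> (nat \<Rightarrow> nat \<Rightarrow> real) \<Rightarrow> real \<Rightarrow> nat \<Rightarrow> nat \<Rightarrow> real" where
  "P_II B J lam n m = (1 / lam) * diag_conj (\<lambda>k. 1 / poly (B k) lam) J n m"

definition P_I ::
  "nat \<Rightarrow> (nat \<Rightarrow> complex \<Rightarrow> complex) \<Rightarrow> (nat \<Rightarrow> nat \<Rightarrow> real poly) \<Rightarrow> (nat \<Rightarrow> nat \<Rightarrow> real) \<Rightarrow> real \<Rightarrow>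
   nat \<Rightarrow> nat \<Rightarrow> real" where
  "P_I p w A J lam n m =
     (1 / lam) * diag_conj (\<lambda>k. 1 / rlinform p w (A k) lam) (\<lambda>i j. J j i) n m"

definition kappa ::
  "nat \<Rightarrow> (nat \<Rightarrow> complex \<Rightarrow> complex) \<Rightarrow> (nat \<Rightarrow> nat \<Rightarrow> real poly) \<Rightarrow> (nat \<Rightarrow> real poly) \<Rightarrow> real \<Rightarrow>
   nat \<Rightarrow> real" where
  "kappa p w A B lam n = poly (B n) lam * rlinform p w (A n) lam"

definition normalized :: "(nat \<Rightarrow> real) \<Rightarrow> nat \<Rightarrow> real" where
  "normalized v n = v n / (\<Sum>k. \<bar>v k\<bar>)"


section \<open>Markov chains on the natural numbers\<close>

text \<open>
  \<open>chain_law P i \<Omega>\<close>: under the measure \<open>\<Omega>\<close> on path space, the coordinate process is the Markov chain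
  with transition matrix \<open>P\<close> started at \<open>i\<close>. For stochastic \<open>P\<close> such a law exists (lemma
  \<open>chain_law_exists\<close>); it is unique since it is prescribed on cylinders.
\<close>

definition chain_law :: "(nat \<Rightarrow> nat \<Rightarrow> real) \<Rightarrow> nat \<Rightarrow> (nat \<Rightarrow> nat) measure \<Rightarrow> bool" where
  "chain_law P i \<Omega> \<longleftrightarrow>
     prob_space \<Omega> \<and> sets \<Omega> = sets (PiM UNIV (\<lambda>_. count_space UNIV)) \<and>
     (\<forall>n x. measure \<Omega> {\<omega>. \<forall>k\<le>n. \<omega> k = x k} =
        (if x 0 = i then \<Prod>k<n. P (x k) (x (Suc k)) else 0))"

definition return_time :: "nat \<Rightarrow> (nat \<Rightarrow> nat) \<Rightarrow> enat" where
  "return_time i \<omega> = Inf (enat ` {n. n \<ge> 1 \<and> \<omega> n = i})"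

definition recurrent_state :: "(nat \<Rightarrow> nat \<Rightarrow> real) \<Rightarrow> nat \<Rightarrow> bool" where
  "recurrent_state P i \<longleftrightarrow>
     (\<forall>\<Omega>. chain_law P i \<Omega> \<longrightarrow> measure \<Omega> {\<omega>. return_time i \<omega> < \<infinity>} = 1)"

definition finite_return_time :: "(nat \<Rightarrow> nat \<Rightarrow> real) \<Rightarrow> nat \<Rightarrow> bool" where
  "finite_return_time P i \<longleftrightarrow>
     (\<forall>\<Omega>. chain_law P i \<Omega> \<longrightarrow> (\<integral>\<^sup>+\<omega>. ennreal_of_enat (return_time i \<omega>) \<partial>\<Omega>) < \<infinity>)"

definition positive_recurrent :: "(nat \<Rightarrow> nat \<Rightarrow> real) \<Rightarrow> bool" where
  "positive_recurrent P \<longleftrightarrow> (\<forall>i. recurrent_state P i \<and> finite_return_time P i)"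

primrec nstep :: "(nat \<Rightarrow> nat \<Rightarrow> real) \<Rightarrow> nat \<Rightarrow> nat \<Rightarrow> nat \<Rightarrow> real" where
  "nstep P 0 i j = (if i = j then 1 else 0)"
| "nstep P (Suc n) i j = (\<Sum>k. P i k * nstep P n k j)"

definition period :: "(nat \<Rightarrow> nat \<Rightarrow> real) \<Rightarrow> nat \<Rightarrow> nat" where
  "period P i = Gcd {n. n \<ge> 1 \<and> nstep P n i i > 0}"

definition aperiodic :: "(nat \<Rightarrow> nat \<Rightarrow> real) \<Rightarrow> bool" where
  "aperiodic P \<longleftrightarrow> (\<forall>i. period P i = 1)"

definition ergodic :: "(nat \<Rightarrow> nat \<Rightarrow> real) \<Rightarrow> bool" where
  "ergodic P \<longleftrightarrow> positive_recurrent P \<and> aperiodic P"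

lemma chain_law_exists:
  assumes "stochastic P"
  shows "\<exists>\<Omega>. chain_law P i \<Omega>"
proof -
  have nn: "0 \<le> P n m" and sm: "(\<lambda>m. P n m) sums 1" for n m
    using assms by (auto simp: stochastic_def)
  define S where "S n = embed_pmf (P n)" for n
  have S: "pmf (S n) m = P n m" for n m
  proof -
    have "(\<integral>\<^sup>+x. ennreal (P n x) \<partial>count_space UNIV) = (\<Sum>x. ennreal (P n x))"
      by (rule nn_integral_count_space_nat)
    also have "\<dots> = ennreal 1"
      by (rule suminf_ennreal_eq[OF nn sm])
    finally have "(\<integral>\<^sup>+x. ennreal (P n x) \<partial>count_space UNIV) = 1" by simp
    then show ?thesis unfolding S_def by (rule pmf_embed_pmf[OF nn])
  qed
  define C0 where "C0 = (\<lambda>_::nat. count_space (UNIV :: nat set))"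
  define K where "K n \<omega> = measure_pmf (case n of 0 \<Rightarrow> return_pmf i | Suc m \<Rightarrow> S (\<omega> m))"
    for n and \<omega> :: "nat \<Rightarrow> nat"
  have K: "K n \<in> measurable (PiM {0..<n} C0) (subprob_algebra (C0 n))" for n
  proof (cases n)
    case 0
    show ?thesis unfolding K_def 0 C0_def
      by (simp add: measurable_const space_subprob_algebra measure_pmf.subprob_space_axioms)
  next
    case (Suc m)
    have 1: "(\<lambda>\<omega>. \<omega> m) \<in> measurable (PiM {0..<n} C0) (C0 m)"
      by (rule measurable_component_singleton) (simp add: Suc)
    have 2: "(\<lambda>k. measure_pmf (S k)) \<in> measurable (C0 m) (subprob_algebra (C0 n))"
      unfolding C0_def by (simp add: space_subprob_algebra measure_pmf.subprob_space_axioms)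
    show ?thesis using measurable_compose[OF 1 2] unfolding K_def Suc by simp
  qed
  interpret IT: Ionescu_Tulcea K C0
    by (rule Ionescu_Tulcea.intro, rule K) (unfold K_def, rule measure_pmf.prob_space_axioms)
  let ?u = "\<lambda>_::nat. undefined :: nat"
  have u: "?u \<in> space (PiM {0..<0} C0)" by (simp add: space_PiM)
  have spC: "restrict x {0..<n} \<in> space (PiM {0..<n} C0)" for x n
    by (auto simp: space_PiM C0_def PiE_iff)
  have sing: "{restrict x {0..<n}} \<in> sets (PiM {0..<n} C0)" for x n
  proof -
    have "{restrict x {0..<n}} = PiE {0..<n} (\<lambda>k. {x k})"
      by (auto simp: PiE_iff fun_eq_iff extensional_def)
    also have "\<dots> \<in> sets (PiM {0..<n} C0)"
      by (rule sets_PiM_I_finite) (auto simp: C0_def)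
    finally show ?thesis .
  qed
  have step: "emeasure (IT.eP n y) {restrict x {0..<Suc n}} =
      K n y {x n} * indicator {restrict x {0..<n}} y"
    if y: "y \<in> space (PiM {0..<n} C0)" for n x y
  proof -
    have ext: "y \<in> extensional {0..<n}" using y by (auto simp: space_PiM PiE_iff)
    have "(\<lambda>v. y(n := v)) -` {restrict x {0..<Suc n}} \<inter> space (C0 n) =
        (if y = restrict x {0..<n} then {x n} else {})"
    proof -
      have *: "y(n := v) = restrict x {0..<Suc n} \<longleftrightarrow> y = restrict x {0..<n} \<and> v = x n" for v
      proof
        assume L: "y(n := v) = restrict x {0..<Suc n}"
        have "v = x n" using fun_cong[OF L, of n] by simp
        moreover have "y = restrict x {0..<n}"
        proof
          fix k show "y k = restrict x {0..<n} k"
            using fun_cong[OF L, of k] ext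
            by (cases "k = n"; cases "k < n") (auto simp: extensional_def)
        qed
        ultimately show "y = restrict x {0..<n} \<and> v = x n" by simp
      next
        assume "y = restrict x {0..<n} \<and> v = x n"
        then show "y(n := v) = restrict x {0..<Suc n}" by (auto simp: fun_eq_iff)
      qed
      show ?thesis unfolding vimage_def singleton_iff * C0_def by auto
    qed
    then show ?thesis using IT.emeasure_eP[OF y sing, of x] by (auto simp: indicator_def)
  qed
  have C: "emeasure (IT.C 0 (Suc n) ?u) {restrict x {0..<Suc n}} =
      ennreal (if x 0 = i then \<Prod>k<n. P (x k) (x (Suc k)) else 0)" for n x
  proof -
    have rec: "emeasure (IT.C 0 (Suc n) ?u) {restrict x {0..<Suc n}} =
        K n (restrict x {0..<n}) {x n} * emeasure (IT.C 0 n ?u) {restrict x {0..<n}}" for n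
    proof -
      have sp: "space (IT.C 0 n ?u) = space (PiM {0..<n} C0)" using IT.space_C[OF u, of n] by simp
      have st: "sets (IT.C 0 n ?u) = sets (PiM {0..<n} C0)" using IT.sets_C[OF u, of n] by simp
      have "emeasure (IT.C 0 (Suc n) ?u) {restrict x {0..<Suc n}} =
          (\<integral>\<^sup>+y. emeasure (IT.eP n y) {restrict x {0..<Suc n}} \<partial>IT.C 0 n ?u)"
        unfolding IT.C.simps add_0
      proof (rule emeasure_bind)
        show "space (IT.C 0 n ?u) \<noteq> {}" using sp spC by auto
        show "IT.eP n \<in> measurable (IT.C 0 n ?u) (subprob_algebra (PiM {0..<Suc n} C0))"
          using IT.measurable_eP[of n] by (simp add: measurable_cong_sets[OF st refl])
      qed (rule sing)
      also have "\<dots> = (\<integral>\<^sup>+y. K n (restrict x {0..<n}) {x n} * indicator {restrict x {0..<n}} y \<partial>IT.C 0 n ?u)"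
        by (intro nn_integral_cong) (auto simp: sp step indicator_def)
      also have "\<dots> = K n (restrict x {0..<n}) {x n} * emeasure (IT.C 0 n ?u) {restrict x {0..<n}}"
        by (rule nn_integral_cmult_indicator) (simp add: st sing)
      finally show ?thesis .
    qed
    show ?thesis
    proof (induction n)
      case 0
      have 1: "emeasure (IT.C 0 0 ?u) {restrict x {0..<0}} = 1"
        by (simp add: PiM_empty restrict_def)
      have 2: "K 0 y {x 0} = ennreal (if x 0 = i then 1 else 0)" for y
        by (simp add: K_def emeasure_pmf_single)
      show ?case unfolding rec[of 0] 1 2 by simp
    next
      case (Suc n)
      have 1: "K (Suc n) (restrict x {0..<Suc n}) {x (Suc n)} = ennreal (P (x n) (x (Suc n)))"
        by (simp add: K_def emeasure_pmf_single S)
      show ?case unfolding rec[of "Suc n"] 1 Suc.IH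
        by (simp add: ennreal_mult[symmetric] nn prod_nonneg mult.commute)
    qed
  qed
  have lim: "emeasure IT.PF.lim {\<omega>. \<forall>k\<le>n. \<omega> k = x k} =
      ennreal (if x 0 = i then \<Prod>k<n. P (x k) (x (Suc k)) else 0)" for n x
  proof -
    have e: "{\<omega>. \<forall>k\<le>n. \<omega> k = x k} = IT.PF.emb UNIV {0..<Suc n} {restrict x {0..<Suc n}}"
      by (auto simp: prod_emb_def C0_def fun_eq_iff less_Suc_eq_le restrict_def split: if_splits)
    have e2: "IT.PF.emb {0..<Suc n} {0..<Suc n} {restrict x {0..<Suc n}} = {restrict x {0..<Suc n}}"
      by (rule prod_emb_id) (use spC in \<open>auto simp: space_PiM\<close>)
    have "emeasure IT.PF.lim {\<omega>. \<forall>k\<le>n. \<omega> k = x k} =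
        emeasure (IT.CI {0..<Suc n}) {restrict x {0..<Suc n}}"
      unfolding e by (rule IT.lim) (auto intro: sing)
    also have "\<dots> = emeasure (IT.C 0 (Suc n) ?u) {restrict x {0..<Suc n}}"
      using IT.emeasure_CI[OF order_refl sing, of "Suc n" x] e2 by simp
    finally show ?thesis using C by simp
  qed
  have "chain_law P i IT.PF.lim"
    unfolding chain_law_def
  proof (intro conjI allI)
    have "emeasure IT.PF.lim (space IT.PF.lim) = 1"
    proof -
      have "space IT.PF.lim = UNIV"
        unfolding IT.PF.space_lim space_PiM by (simp add: C0_def)
      then have "space IT.PF.lim = IT.PF.emb UNIV {} {\<lambda>_. undefined}"
        by (auto simp: prod_emb_def C0_def)
      moreover have "emeasure IT.PF.lim (IT.PF.emb UNIV {} {\<lambda>_. undefined}) =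
          emeasure (IT.CI {}) {\<lambda>_. undefined}"
        by (rule IT.lim) (auto simp: PiM_empty)
      moreover have "emeasure (IT.CI {}) {\<lambda>_. undefined} = 1"
        using prob_space.emeasure_space_1[OF IT.PF.prob_space_P[of "{}"]]
        by (simp add: IT.CI_def PiM_empty space_PiM)
      ultimately show ?thesis by simp
    qed
    then show "prob_space IT.PF.lim" by (rule prob_spaceI)
    show "sets IT.PF.lim = sets (PiM UNIV (\<lambda>_. count_space UNIV))"
      unfolding IT.PF.sets_lim by (simp add: C0_def)
    show "measure IT.PF.lim {\<omega>. \<forall>k\<le>n. \<omega> k = x k} =
        (if x 0 = i then \<Prod>k<n. P (x k) (x (Suc k)) else 0)" for n x
      unfolding measure_def lim by (simp add: prod_nonneg nn)
  qed
  then show ?thesis ..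
qed

end

theory Submission
  imports Defs
begin

text \<open>
  The row \<open>\<kappa>\<close> is the termwise product of a right eigenvector \<open>b = (B\<^sup>(\<^sup>n\<^sup>)(\<lambda>))\<close> of \<open>J\<close> and a right
  eigenvector \<open>q = (Q\<^sup>(\<^sup>n\<^sup>)(\<lambda>))\<close> of \<open>J\<^sup>T\<close>, so it is fixed from the left by the diagonal conjugates of
  both. The relation \<open>J\<^sup>T Q = x Q\<close> comes from biorthogonality of \<open>B\<close> and \<open>Q\<close>, applied to the tuples of
  coefficient polynomials of the linear forms: it is an identity of polynomials and therefore may be
  evaluated at \<open>\<lambda>\<close> outside \<open>\<Delta>\<close>.

  A steady state \<open>\<pi>\<close> with \<open>\<pi>\<^sub>i > 0\<close> makes \<open>i\<close> positive recurrent, without irreducibility (Kac): the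
  chain started in \<open>\<pi>\<close> satisfies
  \<open>\<pi>\<^sub>i P\<^sub>i(T\<^sub>i > n) = P\<^sub>\<pi>(X\<^sub>1, \<dots>, X\<^sub>n \<noteq> i) - P\<^sub>\<pi>(X\<^sub>0, \<dots>, X\<^sub>n \<noteq> i)\<close>, by stationarity this telescopes,
  and hence \<open>E\<^sub>i T\<^sub>i \<le> 1 / \<pi>\<^sub>i\<close>.
\<close>

section \<open>Mean return times and steady states\<close>

text \<open>The probability, starting from \<open>j\<close>, of not visiting \<open>i\<close> at the times \<open>1, \<dots>, n\<close>.\<close>

primrec taboo :: "(nat \<Rightarrow> nat \<Rightarrow> real) \<Rightarrow> nat \<Rightarrow> nat \<Rightarrow> nat \<Rightarrow> ennreal" where
  "taboo P i 0 j = 1"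
| "taboo P i (Suc n) j = (\<Sum>k. ennreal (P j k) * (if k = i then 0 else taboo P i n k))"

section \<open>Path events and their probabilities under the chain law\<close>

lemma enat_less_return_time_iff:
  "enat n < return_time i \<omega> \<longleftrightarrow> (\<forall>k. 1 \<le> k \<and> k \<le> n \<longrightarrow> \<omega> k \<noteq> i)"
proof
  assume L: "enat n < return_time i \<omega>"
  show "\<forall>k. 1 \<le> k \<and> k \<le> n \<longrightarrow> \<omega> k \<noteq> i"
  proof (intro allI impI notI)
    fix k assume k: "1 \<le> k \<and> k \<le> n" "\<omega> k = i"
    then have "return_time i \<omega> \<le> enat k"
      unfolding return_time_def by (intro Inf_lower) auto
    with L have "enat n < enat k" by (rule less_le_trans)
    with k show False by simp
  qed
next
  assume R: "\<forall>k. 1 \<le> k \<and> k \<le> n \<longrightarrow> \<omega> k \<noteq> i"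
  \<comment> \<open>The lower bound also covers a path that never returns: there the infimum is over
    the empty set and equals \<open>\<infinity>\<close>.\<close>
  have "enat (Suc n) \<le> return_time i \<omega>"
    unfolding return_time_def using R by (intro Inf_greatest) (force simp: not_le)
  then show "enat n < return_time i \<omega>" by (simp add: Suc_ile_eq)
qed

lemma sets_path_cylinder:
  fixes \<Omega> :: "(nat \<Rightarrow> nat) measure"
  assumes "sets \<Omega> = sets (PiM UNIV (\<lambda>_. count_space UNIV))"
  shows "{\<omega>. Q (\<omega> k)} \<in> sets \<Omega>"
proof -
  have "{\<omega>. Q (\<omega> k)} = (\<lambda>\<omega>. \<omega> k) -` {y. Q y} \<inter> space (PiM UNIV (\<lambda>_. count_space (UNIV :: nat set)))"
    by (auto simp: space_PiM)
  also have "\<dots> \<in> sets (PiM UNIV (\<lambda>_. count_space (UNIV :: nat set)))"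
    by (rule measurable_sets[OF measurable_component_singleton]) auto
  finally show ?thesis using assms by simp
qed

text \<open>The event is a countable intersection of conditions on one coordinate each; for
  \<open>k > m + n\<close> the condition is vacuous.\<close>

lemma sets_path_taboo:
  fixes \<Omega> :: "(nat \<Rightarrow> nat) measure"
  assumes "sets \<Omega> = sets (PiM UNIV (\<lambda>_. count_space UNIV))"
  shows "{\<omega>. (\<forall>k\<le>m. \<omega> k = x k) \<and> (\<forall>k. m < k \<and> k \<le> m + n \<longrightarrow> \<omega> k \<noteq> i)} \<in> sets \<Omega>"
proof -
  have [simp]: "space \<Omega> = UNIV"
    using sets_eq_imp_space_eq[OF assms] by (simp add: space_PiM)
  have "{\<omega>. (\<forall>k\<le>m. \<omega> k = x k) \<and> (\<forall>k. m < k \<and> k \<le> m + n \<longrightarrow> \<omega> k \<noteq> i)} =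
      (\<Inter>k. {\<omega>. (k \<le> m \<longrightarrow> \<omega> k = x k) \<and> (m < k \<and> k \<le> m + n \<longrightarrow> \<omega> k \<noteq> i)})"
    by auto
  also have "\<dots> \<in> sets \<Omega>"
  proof (rule sets.countable_INT')
    show "range (\<lambda>k. {\<omega>. (k \<le> m \<longrightarrow> \<omega> k = x k) \<and> (m < k \<and> k \<le> m + n \<longrightarrow> \<omega> k \<noteq> i)}) \<subseteq> sets \<Omega>"
      by (rule image_subsetI)
        (rule sets_path_cylinder[OF assms, of "\<lambda>y. (_ \<le> m \<longrightarrow> y = x _) \<and> (m < _ \<and> _ \<le> m + n \<longrightarrow> y \<noteq> i)"])
  qed simp_all
  finally show ?thesis .
qed

text \<open>Since \<open>chain_law\<close> prescribes cylinders only, the event is cut according to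
  the state \<open>y\<close> at time \<open>m + 1\<close>. The prescribed prefix grows by one, the
  taboo window shrinks by one, and countable additivity reproduces the recursion of
  \<open>taboo\<close>. Hence the induction on \<open>n\<close> keeps \<open>m\<close> and
  \<open>x\<close> arbitrary.\<close>

lemma chain_law_taboo:
  assumes P: "stochastic P" and law: "chain_law P i0 \<Omega>"
  shows "emeasure \<Omega> {\<omega>. (\<forall>k\<le>m. \<omega> k = x k) \<and> (\<forall>k. m < k \<and> k \<le> m + n \<longrightarrow> \<omega> k \<noteq> i)} =
    ennreal (if x 0 = i0 then \<Prod>k<m. P (x k) (x (Suc k)) else 0) * taboo P i n (x m)"
proof (induction n arbitrary: m x)
  case 0
  interpret prob_space \<Omega> using law by (simp add: chain_law_def)
  have "{\<omega>. (\<forall>k\<le>m. \<omega> k = x k) \<and> (\<forall>k. m < k \<and> k \<le> m + 0 \<longrightarrow> \<omega> k \<noteq> i)} = {\<omega>. \<forall>k\<le>m. \<omega> k = x k}"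
    by auto
  then show ?case using law by (simp add: emeasure_eq_measure chain_law_def)
next
  case (Suc n)
  have nn: "0 \<le> P a b" for a b using P by (simp add: stochastic_def)
  have S: "sets \<Omega> = sets (PiM UNIV (\<lambda>_. count_space UNIV))"
    using law by (simp add: chain_law_def)
  define c where "c = (if x 0 = i0 then \<Prod>k<m. P (x k) (x (Suc k)) else 0)"
  have c: "c \<ge> 0" unfolding c_def by (auto intro!: prod_nonneg nn)
  \<comment> \<open>\<open>x(Suc m := y)\<close> prolongs the prefix by \<open>y\<close>. The empty
    piece for \<open>y = i\<close> corresponds to the zero term in \<open>taboo\<close>.\<close>
  define E where "E y = (if y = i then {} else {\<omega>. (\<forall>k\<le>Suc m. \<omega> k = (x(Suc m := y)) k) \<and>
      (\<forall>k. Suc m < k \<and> k \<le> Suc m + n \<longrightarrow> \<omega> k \<noteq> i)})" for y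
  have E_emeasure: "emeasure \<Omega> (E y) =
      ennreal c * (ennreal (P (x m) y) * (if y = i then 0 else taboo P i n y))" for y
  proof -
    have "(\<Prod>k<Suc m. P ((x(Suc m := y)) k) ((x(Suc m := y)) (Suc k))) =
        (\<Prod>k<m. P (x k) (x (Suc k))) * P (x m) y"
      by simp
    then show ?thesis
      unfolding E_def using Suc.IH[of "Suc m" "x(Suc m := y)"] c nn
      by (simp add: c_def ennreal_mult prod_nonneg mult.assoc)
  qed
  have disj: "disjoint_family E"
    unfolding disjoint_family_on_def E_def by auto
  have "{\<omega>. (\<forall>k\<le>m. \<omega> k = x k) \<and> (\<forall>k. m < k \<and> k \<le> m + Suc n \<longrightarrow> \<omega> k \<noteq> i)} = (\<Union>y. E y)"
  proof (intro equalityI subsetI)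
    fix \<omega> assume w: "\<omega> \<in> {\<omega>. (\<forall>k\<le>m. \<omega> k = x k) \<and> (\<forall>k. m < k \<and> k \<le> m + Suc n \<longrightarrow> \<omega> k \<noteq> i)}"
    then have "\<omega> \<in> E (\<omega> (Suc m))"
      unfolding E_def by (auto simp: le_Suc_eq)
    then show "\<omega> \<in> (\<Union>y. E y)" by blast
  next
    fix \<omega> assume "\<omega> \<in> (\<Union>y. E y)"
    then obtain y where y: "y \<noteq> i" and a: "\<forall>k\<le>Suc m. \<omega> k = (x(Suc m := y)) k"
      and b: "\<forall>k. Suc m < k \<and> k \<le> Suc m + n \<longrightarrow> \<omega> k \<noteq> i"
      unfolding E_def by (fastforce split: if_splits)
    have "\<omega> k \<noteq> i" if "m < k" "k \<le> m + Suc n" for k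
      using that y a b by (cases "k = Suc m") auto
    moreover have "\<omega> k = x k" if "k \<le> m" for k using that a by auto
    ultimately show "\<omega> \<in> {\<omega>. (\<forall>k\<le>m. \<omega> k = x k) \<and> (\<forall>k. m < k \<and> k \<le> m + Suc n \<longrightarrow> \<omega> k \<noteq> i)}"
      by blast
  qed
  then have "emeasure \<Omega> {\<omega>. (\<forall>k\<le>m. \<omega> k = x k) \<and> (\<forall>k. m < k \<and> k \<le> m + Suc n \<longrightarrow> \<omega> k \<noteq> i)} =
      emeasure \<Omega> (\<Union>y. E y)" by simp
  also have "\<dots> = (\<Sum>y. emeasure \<Omega> (E y))"
  proof (rule suminf_emeasure[symmetric, OF _ disj])
    show "range E \<subseteq> sets \<Omega>" unfolding E_def
      using sets_path_taboo[OF S, where m = "Suc m" and n = n and i = i] by (simp add: image_subset_iff del: fun_upd_apply)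
  qed
  also have "\<dots> = ennreal c * taboo P i (Suc n) (x m)"
    by (simp only: E_emeasure taboo.simps ennreal_suminf_cmult)
  finally show ?case unfolding c_def .
qed

section \<open>Stationarity and the mean return time\<close>

lemma suminf_swap_ennreal:
  fixes f :: "nat \<Rightarrow> nat \<Rightarrow> ennreal"
  shows "(\<Sum>i. \<Sum>j. f i j) = (\<Sum>j. \<Sum>i. f i j)"
proof -
  have "(\<integral>\<^sup>+i. (\<Sum>j. f i j) \<partial>count_space UNIV) = (\<Sum>j. \<integral>\<^sup>+i. f i j \<partial>count_space UNIV)"
    by (rule nn_integral_suminf) simp
  then show ?thesis by (simp add: nn_integral_count_space_nat)
qed

text \<open>With \<open>u\<close> as defined in the proof, the first \<open>N\<close> terms and
  \<open>u N\<close> add up to \<open>u 0 = 1\<close>, so every partial sum is at most 1.\<close>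

lemma taboo_sum_le:
  assumes P: "stochastic P" and nn: "\<And>n. 0 \<le> v n" and v1: "v sums 1"
    and st: "\<And>m. (\<lambda>n. v n * P n m) sums v m"
  shows "(\<Sum>n. ennreal (v i) * taboo P i n i) \<le> 1"
proof -
  have Pnn: "0 \<le> P a b" for a b using P by (simp add: stochastic_def)
  \<comment> \<open>\<open>u n\<close> is the probability of avoiding \<open>i\<close> at the times
    1 to \<open>n\<close> when the initial law is \<open>v\<close>.\<close>
  define u where "u n = (\<Sum>j. ennreal (v j) * taboo P i n j)" for n
  \<comment> \<open>Stationarity absorbs the first step, so \<open>u (Suc n)\<close> is also the
    probability of avoiding \<open>i\<close> at the times 0 to \<open>n\<close>.\<close>
  have u_Suc: "u (Suc n) = (\<Sum>k. ennreal (v k) * (if k = i then 0 else taboo P i n k))" for n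
  proof -
    let ?g = "\<lambda>k. if k = i then 0 else taboo P i n k"
    have "u (Suc n) = (\<Sum>j. \<Sum>k. ennreal (v j * P j k) * ?g k)"
      unfolding u_def taboo.simps ennreal_suminf_cmult[symmetric]
      by (simp add: ennreal_mult nn Pnn mult.assoc)
    also have "\<dots> = (\<Sum>k. \<Sum>j. ennreal (v j * P j k) * ?g k)"
      by (rule suminf_swap_ennreal)
    also have "\<dots> = (\<Sum>k. ennreal (v k) * ?g k)"
    proof (intro suminf_cong)
      fix k
      have "(\<Sum>j. ennreal (v j * P j k)) = ennreal (v k)"
        by (rule suminf_ennreal_eq[OF _ st]) (simp add: nn Pnn)
      then show "(\<Sum>j. ennreal (v j * P j k) * ?g k) = ennreal (v k) * ?g k"
        by (simp only: ennreal_suminf_multc)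
    qed
    finally show ?thesis .
  qed
  \<comment> \<open>The two probabilities differ by the paths that start at \<open>i\<close>. The
    sum form avoids subtraction in \<open>ennreal\<close>.\<close>
  have u_split: "u n = ennreal (v i) * taboo P i n i + u (Suc n)" for n
  proof -
    have "u n = (\<Sum>k. (if k = i then ennreal (v k) * taboo P i n k else 0) +
        ennreal (v k) * (if k = i then 0 else taboo P i n k))"
      unfolding u_def by (intro suminf_cong) auto
    also have "\<dots> = (\<Sum>k. if k = i then ennreal (v k) * taboo P i n k else 0) + u (Suc n)"
      unfolding u_Suc by (rule suminf_add[symmetric]) auto
    also have "(\<Sum>k. if k = i then ennreal (v k) * taboo P i n k else 0) =
        ennreal (v i) * taboo P i n i"
      by (subst suminf_finite[of "{i}"]) auto
    finally show ?thesis .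
  qed
  have "(\<Sum>n<N. ennreal (v i) * taboo P i n i) + u N = 1" for N
  proof (induction N)
    case 0
    show ?case unfolding u_def by (simp add: suminf_ennreal_eq[OF nn v1])
  next
    case (Suc N)
    then show ?case using u_split[of N] by (simp add: add.assoc)
  qed
  then have "(\<Sum>n<N. ennreal (v i) * taboo P i n i) \<le> 1" for N
    by (metis le_iff_add)
  then show ?thesis by (intro suminf_le_const) auto
qed

text \<open>The mean of a variable with values in \<open>enat\<close> is the sum of its tail
  probabilities, and for the chain started at \<open>i\<close> the tail beyond \<open>n\<close> is
  \<open>taboo P i n i\<close>.\<close>

lemma chain_law_mean_return_time:
  assumes P: "stochastic P" and law: "chain_law P i \<Omega>"
  shows "return_time i \<in> measurable \<Omega> (count_space UNIV)"
    and "(\<integral>\<^sup>+\<omega>. ennreal_of_enat (return_time i \<omega>) \<partial>\<Omega>) = (\<Sum>n. taboo P i n i)"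
proof -
  interpret prob_space \<Omega> using law by (simp add: chain_law_def)
  have S: "sets \<Omega> = sets (PiM UNIV (\<lambda>_. count_space UNIV))"
    using law by (simp add: chain_law_def)
  have sp: "space \<Omega> = UNIV"
    using sets_eq_imp_space_eq[OF S] by (simp add: space_PiM)
  have G: "{\<omega>. enat n < return_time i \<omega>} \<in> sets \<Omega>" for n
  proof -
    have "{\<omega>. enat n < return_time i \<omega>} = (\<Inter>k. {\<omega>. 1 \<le> k \<and> k \<le> n \<longrightarrow> \<omega> k \<noteq> i})"
      by (auto simp: enat_less_return_time_iff)
    also have "\<dots> \<in> sets \<Omega>"
    proof (rule sets.countable_INT')
      show "range (\<lambda>k. {\<omega>. 1 \<le> k \<and> k \<le> n \<longrightarrow> \<omega> k \<noteq> i}) \<subseteq> sets \<Omega>"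
        by (rule image_subsetI)
          (rule sets_path_cylinder[OF S, of "\<lambda>y. 1 \<le> _ \<and> _ \<le> n \<longrightarrow> y \<noteq> i"])
    qed simp_all
    finally show ?thesis .
  qed
  \<comment> \<open>An element of \<open>enat\<close> is determined by the finite \<open>n\<close>
    strictly below it, so each level set is a countable intersection of tail events and their
    complements.\<close>
  have eq: "{\<omega>. return_time i \<omega> = a} =
      (\<Inter>n. if enat n < a then {\<omega>. enat n < return_time i \<omega>} else - {\<omega>. enat n < return_time i \<omega>})" for a
  proof -
    have enat_less_ext: "x = y" if "\<And>n. enat n < x \<longleftrightarrow> enat n < y" for x y :: enat
    proof (rule ccontr)
      assume "x \<noteq> y"
      then consider "x < y" | "y < x" by (meson linorder_neqE)
      then show False
      proof cases
        case 1
        then obtain n where "x = enat n" by (cases x) auto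
        then show False using that[of n] 1 by simp
      next
        case 2
        then obtain n where "y = enat n" by (cases y) auto
        then show False using that[of n] 2 by simp
      qed
    qed
    have "return_time i \<omega> = a \<longleftrightarrow>
        (\<forall>n. \<omega> \<in> (if enat n < a then {\<omega>. enat n < return_time i \<omega>} else - {\<omega>. enat n < return_time i \<omega>}))" for \<omega>
      using enat_less_ext[of "return_time i \<omega>" a] by auto
    then show ?thesis by blast
  qed
  have "{\<omega>. return_time i \<omega> = a} \<in> sets \<Omega>" for a
    unfolding eq
  proof (rule sets.countable_INT')
    have "- {\<omega>. enat n < return_time i \<omega>} \<in> sets \<Omega>" for n
      using sets.compl_sets[OF G[of n]] by (simp add: sp Compl_eq_Diff_UNIV)
    then show "range (\<lambda>n. if enat n < a then {\<omega>. enat n < return_time i \<omega>}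
        else - {\<omega>. enat n < return_time i \<omega>}) \<subseteq> sets \<Omega>"
      using G by (simp add: image_subset_iff)
  qed simp_all
  then show m: "return_time i \<in> measurable \<Omega> (count_space UNIV)"
    by (subst measurable_count_space_eq2_countable) (auto simp: sp vimage_def)
  have "prob {\<omega>. \<forall>k\<le>n. \<omega> k = x k} =
      (if x 0 = i then \<Prod>k<n. P (x k) (x (Suc k)) else 0)" for n x
    using law unfolding chain_law_def by blast
  \<comment> \<open>For \<open>n = 0\<close> the product is empty, so the path starts at
    \<open>i\<close> almost surely. This is needed because the event in
    \<open>chain_law_taboo\<close> fixes the state at time 0, whereas the tail event of the return
    time does not mention it.\<close>
  from this[of 0 "\<lambda>_. i"] have "prob {\<omega>. \<omega> 0 = i} = 1" by simp
  then have AE0: "AE \<omega> in \<Omega>. \<omega> 0 = i"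
    using sets_path_cylinder[OF S, of "\<lambda>y. y = i" 0] by (simp add: prob_eq_1)
  have "emeasure \<Omega> {\<omega> \<in> space \<Omega>. enat n < return_time i \<omega>} = taboo P i n i" for n
  proof -
    have "emeasure \<Omega> {\<omega> \<in> space \<Omega>. enat n < return_time i \<omega>} =
       emeasure \<Omega> {\<omega>. (\<forall>k\<le>0. \<omega> k = i) \<and> (\<forall>k. 0 < k \<and> k \<le> 0 + n \<longrightarrow> \<omega> k \<noteq> i)}"
    proof (rule emeasure_eq_AE)
      show "AE \<omega> in \<Omega>. \<omega> \<in> {\<omega> \<in> space \<Omega>. enat n < return_time i \<omega>} \<longleftrightarrow>
          \<omega> \<in> {\<omega>. (\<forall>k\<le>0. \<omega> k = i) \<and> (\<forall>k. 0 < k \<and> k \<le> 0 + n \<longrightarrow> \<omega> k \<noteq> i)}"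
        using AE0 by eventually_elim (auto simp: enat_less_return_time_iff sp)
      show "{\<omega> \<in> space \<Omega>. enat n < return_time i \<omega>} \<in> sets \<Omega>"
        using G by (simp add: sp)
    qed (rule sets_path_taboo[OF S])
    then show ?thesis using chain_law_taboo[OF P law, where m = 0 and x = "\<lambda>_. i" and n = n and i = i] by simp
  qed
  then show "(\<integral>\<^sup>+\<omega>. ennreal_of_enat (return_time i \<omega>) \<partial>\<Omega>) = (\<Sum>n. taboo P i n i)"
    by (simp add: nn_integral_enat_function[OF m])
qed

text \<open>By \<open>taboo_sum_le\<close>, \<open>v i\<close> times the mean return time to
  \<open>i\<close> is at most 1, so \<open>v i > 0\<close> makes the mean finite. A finite mean
  forces the return time to be finite almost surely, which is recurrence.\<close>

lemma steady_state_imp_positive_recurrent: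
  assumes P: "stochastic P" and v: "steady_state v P" and pos: "\<And>n. v n > 0"
  shows "positive_recurrent P"
  unfolding positive_recurrent_def
proof (intro allI conjI)
  fix i
  have fin: "(\<integral>\<^sup>+\<omega>. ennreal_of_enat (return_time i \<omega>) \<partial>\<Omega>) < \<infinity>" if "chain_law P i \<Omega>" for \<Omega>
  proof -
    have "ennreal (v i) * (\<Sum>n. taboo P i n i) \<le> 1"
      using taboo_sum_le[OF P, of v i] v by (simp add: steady_state_def ennreal_suminf_cmult)
    then have "(\<Sum>n. taboo P i n i) \<noteq> \<infinity>"
      using pos[of i] by (auto simp: ennreal_mult_top top_unique)
    then show ?thesis
      by (simp add: chain_law_mean_return_time(2)[OF P that] less_top)
  qed
  then show "finite_return_time P i" by (simp add: finite_return_time_def)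
  show "recurrent_state P i"
    unfolding recurrent_state_def
  proof (intro allI impI)
    fix \<Omega> assume law: "chain_law P i \<Omega>"
    then interpret prob_space \<Omega> by (simp add: chain_law_def)
    have m[measurable]: "return_time i \<in> measurable \<Omega> (count_space UNIV)"
      by (rule chain_law_mean_return_time(1)[OF P law])
    have sp: "space \<Omega> = UNIV"
      using law sets_eq_imp_space_eq[of \<Omega>] by (simp add: chain_law_def space_PiM)
    have "AE \<omega> in \<Omega>. ennreal_of_enat (return_time i \<omega>) \<noteq> \<infinity>"
      using fin[OF law] by (intro nn_integral_PInf_AE) auto
    then have "AE \<omega> in \<Omega>. return_time i \<omega> < \<infinity>"
      by eventually_elim (metis enat_ord_simps(4) ennreal_of_enat_infty infinity_ennreal_def)
    then show "measure \<Omega> {\<omega>. return_time i \<omega> < \<infinity>} = 1"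
      using prob_Collect_eq_1[of "\<lambda>\<omega>. return_time i \<omega> < \<infinity>"] measurable_sets[OF m, of "{..<\<infinity>}"]
      by (simp add: sp vimage_def)
  qed
qed

section \<open>Biorthogonality and the transposed Jacobi matrix\<close>

lemma smult_sum_right: "smult c (\<Sum>i\<in>S. q i) = (\<Sum>i\<in>S. smult c (q i))"
  by (induction S rule: infinite_finite_induct) (simp_all add: smult_add_right)

lemma poly_map_of_real:
  "poly (map_poly complex_of_real q) (complex_of_real x) = complex_of_real (poly q x)"
  by (induction q) (simp_all add: map_poly_pCons)

text \<open>
  Linear forms are represented by their coefficient tuples, indexed by \<open>I\<close>: the tuple \<open>e j\<close> stands for
  \<open>\<xi>\<^sup>(\<^sup>j\<^sup>)\<close>, and \<open>F a q\<close> for \<open>\<integral> q w\<^sub>a d\<mu>\<close>.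
\<close>

locale biorthogonal_system =
  fixes I :: "nat set" and F :: "nat \<Rightarrow> real poly \<Rightarrow> real" and e :: "nat \<Rightarrow> nat \<Rightarrow> real poly"
    and A :: "nat \<Rightarrow> nat \<Rightarrow> real poly" and B :: "nat \<Rightarrow> real poly" and J :: "nat \<Rightarrow> nat \<Rightarrow> real"
  assumes F_add: "F a (q + r) = F a q + F a r"
    and F_smult: "F a (smult c q) = c * F a q"
    and B_monic: "degree (B l) = l" "lead_coeff (B l) = 1"
    and B_orth: "j < l \<Longrightarrow> (\<Sum>a\<in>I. F a (B l * e j a)) = 0"
    and A_comb: "\<exists>c. \<forall>a\<in>I. A l a = (\<Sum>j\<le>l. smult (c j) (e j a))"
    and A_mom: "i \<le> l \<Longrightarrow> (\<Sum>a\<in>I. F a (monom 1 i * A l a)) = (if i = l then 1 else 0)"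
    and e_shift: "\<exists>j'. \<forall>a\<in>I. [:0, 1:] * e j a = e j' a"
    and J: "jacobi_matrix B J"
begin

text \<open>This plays the role of the integral of \<open>q\<close> times the linear form with
  coefficient tuple \<open>T\<close>.\<close>

definition pairing :: "real poly \<Rightarrow> (nat \<Rightarrow> real poly) \<Rightarrow> real" where
  "pairing q T = (\<Sum>a\<in>I. F a (q * T a))"

lemma F_sum: "F a (\<Sum>i\<in>S. smult (c i) (q i)) = (\<Sum>i\<in>S. c i * F a (q i))"
proof (induction S rule: infinite_finite_induct)
  case empty
  show ?case using F_smult[of a 0 0] by simp
next
  case (infinite S)
  show ?case using F_smult[of a 0 0] infinite by simp
qed (simp add: F_add F_smult)

lemma pairing_sum_left:
  "pairing (\<Sum>i\<in>S. smult (c i) (q i)) T = (\<Sum>i\<in>S. c i * pairing (q i) T)"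
proof -
  have "pairing (\<Sum>i\<in>S. smult (c i) (q i)) T = (\<Sum>a\<in>I. \<Sum>i\<in>S. c i * F a (q i * T a))"
    unfolding pairing_def by (simp add: sum_distrib_right F_sum)
  also have "\<dots> = (\<Sum>i\<in>S. c i * pairing (q i) T)"
    unfolding pairing_def by (subst sum.swap) (simp add: sum_distrib_left)
  finally show ?thesis .
qed

lemma pairing_sum_right:
  assumes "\<And>a. a \<in> I \<Longrightarrow> T a = (\<Sum>i\<in>S. smult (c i) (U i a))"
  shows "pairing q T = (\<Sum>i\<in>S. c i * pairing q (U i))"
proof -
  have "pairing q T = (\<Sum>a\<in>I. \<Sum>i\<in>S. c i * F a (q * U i a))"
    unfolding pairing_def by (intro sum.cong refl) (simp add: assms sum_distrib_left F_sum)
  also have "\<dots> = (\<Sum>i\<in>S. c i * pairing q (U i))"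
    unfolding pairing_def by (subst sum.swap) (simp add: sum_distrib_left)
  finally show ?thesis .
qed

text \<open>For \<open>m \<le> l\<close> the polynomial \<open>B m\<close> is expanded in powers,
  and only the moment of order \<open>l\<close> of \<open>A l\<close> survives, with the leading
  coefficient 1 of \<open>B l\<close>. For \<open>m > l\<close> the tuple \<open>A l\<close> is
  expanded in the \<open>e j\<close> with \<open>j \<le> l\<close>, all orthogonal to
  \<open>B m\<close>.\<close>

lemma biorthogonality: "pairing (B m) (A l) = (if m = l then 1 else 0)"
proof (cases "m \<le> l")
  case True
  have "B m = (\<Sum>i\<le>m. smult (coeff (B m) i) (monom 1 i))"
    using poly_as_sum_of_monoms[of "B m"] B_monic(1)[of m] by (simp add: smult_monom)
  then have "pairing (B m) (A l) = (\<Sum>i\<le>m. coeff (B m) i * pairing (monom 1 i) (A l))"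
    using pairing_sum_left by metis
  also have "\<dots> = (\<Sum>i\<le>m. coeff (B m) i * (if i = l then 1 else 0))"
    using True A_mom by (intro sum.cong) (auto simp: pairing_def)
  also have "\<dots> = (if m = l then 1 else 0)"
    using True B_monic[of m] by (auto simp: sum.delta' if_distrib cong: if_cong)
  finally show ?thesis .
next
  case False
  obtain c where "\<forall>a\<in>I. A l a = (\<Sum>j\<le>l. smult (c j) (e j a))" using A_comb by blast
  then have "pairing (B m) (A l) = (\<Sum>j\<le>l. c j * pairing (B m) (e j))"
    by (intro pairing_sum_right) auto
  also have "\<dots> = 0"
    using False B_orth by (intro sum.neutral) (auto simp: pairing_def)
  finally show ?thesis using False by simp
qed

text \<open>Tuples are compared on \<open>I\<close> only, since the other components do not enter
  \<open>pairing\<close>.\<close>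

definition in_span :: "(nat \<Rightarrow> real poly) \<Rightarrow> bool" where
  "in_span T \<longleftrightarrow> (\<exists>N d. \<forall>a\<in>I. T a = (\<Sum>m<N. smult (d m) (A m a)))"

lemma in_span_A: "in_span (A n)"
  unfolding in_span_def
  by (rule exI[of _ "Suc n"], rule exI[of _ "\<lambda>m. if m = n then 1 else 0"])
    (simp add: if_distrib[of "\<lambda>c. smult c _"] cong: if_cong)

lemma in_span_smult: "in_span T \<Longrightarrow> in_span (\<lambda>a. smult c (T a))"
  unfolding in_span_def
proof (elim exE)
  fix N d assume "\<forall>a\<in>I. T a = (\<Sum>m<N. smult (d m) (A m a))"
  then show "\<exists>N d. \<forall>a\<in>I. smult c (T a) = (\<Sum>m<N. smult (d m) (A m a))"
    by (intro exI[of _ N] exI[of _ "\<lambda>m. c * d m"]) (simp add: smult_sum_right)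
qed

lemma in_span_add:
  assumes "in_span T" "in_span U"
  shows "in_span (\<lambda>a. T a + U a)"
proof -
  obtain N d where T: "\<forall>a\<in>I. T a = (\<Sum>m<N. smult (d m) (A m a))"
    using assms(1) unfolding in_span_def by blast
  obtain N' d' where U: "\<forall>a\<in>I. U a = (\<Sum>m<N'. smult (d' m) (A m a))"
    using assms(2) unfolding in_span_def by blast
  \<comment> \<open>Both combinations are padded with zero coefficients to the common length
    \<open>N + N'\<close>.\<close>
  have ext: "(\<Sum>m<n. smult (c m) (A m a)) = (\<Sum>m<N + N'. smult (if m < n then c m else 0) (A m a))"
    if "n \<le> N + N'" for n c a
    using that by (intro sum.mono_neutral_cong_left) auto
  show ?thesis unfolding in_span_def
    by (rule exI[of _ "N + N'"],
        rule exI[of _ "\<lambda>m. (if m < N then d m else 0) + (if m < N' then d' m else 0)"])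
      (simp add: T U ext[of N] ext[of N'] smult_add_left sum.distrib)
qed

lemma in_span_cong: "in_span T \<Longrightarrow> (\<And>a. a \<in> I \<Longrightarrow> T a = U a) \<Longrightarrow> in_span U"
  unfolding in_span_def by fastforce

lemma in_span_sum:
  assumes "finite S" "\<And>i. i \<in> S \<Longrightarrow> in_span (U i)"
  shows "in_span (\<lambda>a. \<Sum>i\<in>S. smult (c i) (U i a))"
  using assms
proof (induction S rule: finite_induct)
  case empty
  show ?case using in_span_smult[OF in_span_A, of 0] by simp
qed (simp add: in_span_add in_span_smult)

text \<open>The passage from the \<open>e j\<close> to the \<open>A j\<close> is triangular, so it
  can be inverted once the diagonal coefficient \<open>c j\<close> is nonzero. Pairing
  \<open>A j\<close> with \<open>B j\<close> shows this: the value is 1, and the terms below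
  \<open>j\<close> vanish.\<close>

lemma in_span_e: "in_span (e j)"
proof (induction j rule: less_induct)
  case (less j)
  obtain c where c: "\<forall>a\<in>I. A j a = (\<Sum>i\<le>j. smult (c i) (e i a))" using A_comb by blast
  have "1 = (\<Sum>i\<le>j. c i * pairing (B j) (e i))"
    using biorthogonality[of j j] pairing_sum_right[where T = "A j" and S = "{..j}" and c = c and U = e and q = "B j"] c by simp
  also have "\<dots> = (\<Sum>i<j. c i * pairing (B j) (e i)) + c j * pairing (B j) (e j)"
    by (simp add: lessThan_Suc_atMost[symmetric])
  also have "(\<Sum>i<j. c i * pairing (B j) (e i)) = 0"
    using B_orth by (intro sum.neutral) (auto simp: pairing_def)
  finally have nz: "c j \<noteq> 0" by auto
  have "in_span (\<lambda>a. smult (1 / c j) (A j a) + (\<Sum>i<j. smult (- c i / c j) (e i a)))"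
    using less by (intro in_span_add in_span_smult in_span_A in_span_sum) auto
  then show ?case
  proof (rule in_span_cong)
    fix a assume "a \<in> I"
    then have "A j a = (\<Sum>i<j. smult (c i) (e i a)) + smult (c j) (e j a)"
      using c by (simp add: lessThan_Suc_atMost[symmetric])
    then show "smult (1 / c j) (A j a) + (\<Sum>i<j. smult (- c i / c j) (e i a)) = e j a"
      using nz by (simp add: smult_add_right smult_sum_right sum.distrib[symmetric] smult_add_left[symmetric])
  qed
qed

text \<open>The tuple of \<open>A n\<close> multiplied by the variable is a finite combination of
  the \<open>A m\<close>, because \<open>e_shift\<close> and \<open>in_span_e\<close> keep it in
  their span. Biorthogonality identifies the coefficients with column \<open>n\<close> of
  \<open>J\<close>; finiteness of that column comes out as well, whereas
  \<open>jacobi_matrix\<close> only speaks of finite rows.\<close>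

lemma jacobi_transpose:
  "\<exists>N. (\<forall>m\<ge>N. J m n = 0) \<and>
    (\<forall>a\<in>I. [:0, 1:] * A n a = (\<Sum>m<N. smult (J m n) (A m a)))"
proof -
  obtain c where c: "\<forall>a\<in>I. A n a = (\<Sum>j\<le>n. smult (c j) (e j a))" using A_comb by blast
  have "in_span (\<lambda>a. [:0, 1:] * e j a)" for j
    using e_shift[of j] in_span_e by (metis in_span_cong)
  then have "in_span (\<lambda>a. \<Sum>j\<le>n. smult (c j) ([:0, 1:] * e j a))"
    by (intro in_span_sum) auto
  then have "in_span (\<lambda>a. [:0, 1:] * A n a)"
    by (rule in_span_cong) (simp add: c sum_distrib_left)
  then obtain N d where d: "\<forall>a\<in>I. [:0, 1:] * A n a = (\<Sum>m<N. smult (d m) (A m a))"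
    unfolding in_span_def by blast
  \<comment> \<open>The pairing of \<open>B k\<close> with the shifted \<open>A n\<close> is
    computed twice: expanding the tuple gives \<open>d k\<close>, and moving the variable over to
    \<open>B k\<close> gives \<open>J k n\<close>.\<close>
  have J_eq: "J k n = (if k < N then d k else 0)" for k
  proof -
    have fin: "finite {m. J k m \<noteq> 0}"
      and xB: "[:0, 1:] * B k = (\<Sum>m | J k m \<noteq> 0. smult (J k m) (B m))"
      using J unfolding jacobi_matrix_def by auto
    have "pairing (B k) (\<lambda>a. [:0, 1:] * A n a) = (\<Sum>m<N. d m * pairing (B k) (A m))"
      using d by (intro pairing_sum_right) auto
    also have "\<dots> = (if k < N then d k else 0)"
      by (simp add: biorthogonality if_distrib[of "\<lambda>x. _ * x"] cong: if_cong)
    finally have 1: "pairing (B k) (\<lambda>a. [:0, 1:] * A n a) = (if k < N then d k else 0)" .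
    have "pairing (B k) (\<lambda>a. [:0, 1:] * A n a) = pairing ([:0, 1:] * B k) (A n)"
      unfolding pairing_def by (intro sum.cong refl arg_cong[of _ _ "F _"]) (simp only: ac_simps)
    also have "\<dots> = (\<Sum>m | J k m \<noteq> 0. J k m * pairing (B m) (A n))"
      unfolding xB by (rule pairing_sum_left)
    also have "\<dots> = J k n"
      using fin by (simp add: biorthogonality if_distrib[of "\<lambda>x. _ * x"] cong: if_cong)
    finally show ?thesis using 1 by simp
  qed
  have "(\<Sum>m<N. smult (d m) (A m a)) = (\<Sum>m<N. smult (J m n) (A m a))" for a
    by (intro sum.cong) (auto simp: J_eq)
  then show ?thesis using d J_eq by (intro exI[of _ N]) auto
qed

end

section \<open>Realisation by integrals and the staircase indexing\<close>

lemma rlinform_eq: "rlinform p w A x = (\<Sum>a=1..p. poly (A a) x * rw w a x)"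
  unfolding rlinform_def linform_def rw_def by (simp add: poly_map_of_real)

lemma integrable_poly_weight:
  assumes "weights_on \<Delta> M p w D" "a \<in> {1..p}"
  shows "integrable M (\<lambda>x. poly q x * rw w a x)"
proof -
  have "integrable M (\<lambda>x. \<Sum>i\<le>degree q. coeff q i * (x ^ i * rw w a x))"
    using assms unfolding weights_on_def by (intro Bochner_Integration.integrable_sum) auto
  then show ?thesis by (simp add: poly_altdef sum_distrib_right mult.assoc)
qed

text \<open>Division of \<open>k\<close> by \<open>nv a\<close> supplies the quotient and remainder
  of the staircase index.\<close>

lemma idx_surj:
  assumes pos: "\<And>a. a \<in> {1..p} \<Longrightarrow> nv a > 0" and a: "a \<in> {1..p}"
  obtains j where "aidx p nv j = a" "kidx p nv j = k"
proof -
  define j where "j = (k div nv a) * size_n p nv + (\<Sum>b=1..<a. nv b) + k mod nv a"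
  have "k mod nv a < nv a" using pos[OF a] by simp
  from idx_unique[OF a this j_def] have "aidx p nv j = a" "kidx p nv j = k"
    by (simp_all add: kidx_def)
  then show thesis by (rule that)
qed

text \<open>The functional is set to 0 for \<open>a\<close> outside \<open>{1..p}\<close>: the
  locale asks for linearity at every \<open>a\<close>, while integrability is known for the weights
  only. The tuple for \<open>j\<close> has a single nonzero component, the monomial of
  \<open>xi p w nv j\<close>.\<close>

lemma multiple_orthogonal_biorthogonal_system:
  assumes p: "p \<ge> 1" and nv: "\<forall>a\<in>{1..p}. nv a > 0"
    and w: "weights_on \<Delta> M p w D"
    and B: "typeII_mops M s p w nv B" and A: "typeI_mops M s p w nv A"
    and J: "jacobi_matrix B J"
  shows "biorthogonal_system {1..p}
    (\<lambda>a q. if a \<in> {1..p} then mint M s (\<lambda>x. poly q x * rw w a x) else 0)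
    (\<lambda>j a. if aidx p nv j = a then monom 1 (kidx p nv j) else 0) A B J"
proof
  note int = integrable_poly_weight[OF w]
  let ?F = "\<lambda>a q. if a \<in> {1..p} then mint M s (\<lambda>x. poly q x * rw w a x) else 0"
  let ?e = "\<lambda>j a. if aidx p nv j = a then monom 1 (kidx p nv j) else 0 :: real poly"
  have F0: "?F a 0 = 0" for a by (simp add: mint_def)
  show "?F a (q + r) = ?F a q + ?F a r" for a q r
    by (simp add: mint_def distrib_right int distrib_left)
  show "?F a (smult c q) = c * ?F a q" for a c q
    by (simp add: mint_def mult.assoc)
  show "degree (B l) = l" "lead_coeff (B l) = 1" for l
    using B unfolding typeII_mops_def by blast+
  show "(\<Sum>a\<in>{1..p}. ?F a (B l * ?e j a)) = 0" if "j < l" for j l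
  proof -
    have a: "aidx p nv j \<in> {1..p}" using idx_decomp(2)[OF p] nv by blast
    have "(\<Sum>a\<in>{1..p}. ?F a (B l * ?e j a)) =
        (\<Sum>a\<in>{1..p}. if a = aidx p nv j then mint M s (\<lambda>x. poly (B l) x * xi p w nv j x) else 0)"
      by (intro sum.cong) (auto simp: F0 poly_monom xi_def mint_def mult.assoc)
    also have "\<dots> = 0"
      using a that B by (simp add: typeII_mops_def)
    finally show ?thesis .
  qed
  show "\<exists>c. \<forall>a\<in>{1..p}. A l a = (\<Sum>j\<le>l. smult (c j) (?e j a))" for l
  proof -
    obtain c where c: "\<forall>a\<in>{1..p}.
        A l a = (\<Sum>j | j \<le> l \<and> aidx p nv j = a. monom (c j) (kidx p nv j))"
      using A unfolding typeI_mops_def by blast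
    have "(\<Sum>j | j \<le> l \<and> aidx p nv j = a. monom (c j) (kidx p nv j)) =
        (\<Sum>j\<le>l. smult (c j) (?e j a))" for a
      by (rule sum.mono_neutral_cong_left) (auto simp: smult_monom)
    with c show ?thesis by auto
  qed
  show "(\<Sum>a\<in>{1..p}. ?F a (monom 1 i * A l a)) = (if i = l then 1 else 0)" if "i \<le> l" for i l
  proof -
    have "(\<Sum>a\<in>{1..p}. ?F a (monom 1 i * A l a)) =
        s * (\<Sum>a\<in>{1..p}. LINT x|M. poly (monom 1 i * A l a) x * rw w a x)"
      by (simp add: mint_def sum_distrib_left)
    also have "\<dots> = mint M s (\<lambda>x. \<Sum>a\<in>{1..p}. poly (monom 1 i * A l a) x * rw w a x)"
      unfolding mint_def by (subst Bochner_Integration.integral_sum) (rule int, simp_all)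
    also have "\<dots> = mint M s (\<lambda>x. x ^ i * rlinform p w (A l) x)"
      by (simp add: rlinform_eq sum_distrib_left poly_monom mult.assoc)
    also have "\<dots> = (if i = l then 1 else 0)"
      using A that by (simp add: typeI_mops_def)
    finally show ?thesis .
  qed
  show "\<exists>j'. \<forall>a\<in>{1..p}. [:0, 1:] * ?e j a = ?e j' a" for j
  proof -
    have "aidx p nv j \<in> {1..p}" using idx_decomp(2)[OF p] nv by blast
    \<comment> \<open>Multiplication by the variable keeps the weight and raises the exponent by
      one, which is again a member of the staircase.\<close>
    then obtain j' where "aidx p nv j' = aidx p nv j" "kidx p nv j' = Suc (kidx p nv j)"
      using idx_surj[of p nv "aidx p nv j" "Suc (kidx p nv j)"] nv by blast
    then show ?thesis by (intro exI[of _ j']) (auto simp: monom_Suc)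
  qed
qed (rule J)

text \<open>The recurrence holds between coefficient polynomials, weight by weight. It can therefore
  be evaluated at any real \<open>x\<close> before the weights are multiplied in.\<close>

lemma jacobi_transpose_rlinform:
  assumes "p \<ge> 1" and "\<forall>a\<in>{1..p}. nv a > 0" and "weights_on \<Delta> M p w D"
    and "typeII_mops M s p w nv B" and "typeI_mops M s p w nv A" and "jacobi_matrix B J"
  shows "(\<lambda>m. J m n * rlinform p w (A m) x) sums (x * rlinform p w (A n) x)"
proof -
  obtain N where N: "\<forall>m\<ge>N. J m n = 0"
    and X: "\<forall>a\<in>{1..p}. [:0, 1:] * A n a = (\<Sum>m<N. smult (J m n) (A m a))"
    using biorthogonal_system.jacobi_transpose[OF multiple_orthogonal_biorthogonal_system[OF assms]] by blast
  have "x * poly (A n a) x = (\<Sum>m<N. J m n * poly (A m a) x)" if "a \<in> {1..p}" for a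
    using arg_cong[OF bspec[OF X that], of "\<lambda>q. poly q x"] by (simp add: poly_sum)
  then have "x * rlinform p w (A n) x = (\<Sum>a=1..p. \<Sum>m<N. J m n * (poly (A m a) x * rw w a x))"
    unfolding rlinform_eq sum_distrib_left
    by (intro sum.cong refl) (simp add: mult.assoc[symmetric] sum_distrib_right)
  also have "\<dots> = (\<Sum>m<N. J m n * rlinform p w (A m) x)"
    unfolding rlinform_eq sum_distrib_left by (rule sum.swap)
  finally have "x * rlinform p w (A n) x = (\<Sum>m<N. J m n * rlinform p w (A m) x)" .
  moreover have "(\<lambda>m. J m n * rlinform p w (A m) x) sums (\<Sum>m<N. J m n * rlinform p w (A m) x)"
    using N by (intro sums_finite) auto
  ultimately show ?thesis by simp
qed

lemma jacobi_poly:
  assumes "jacobi_matrix B J"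
  shows "(\<lambda>m. J n m * poly (B m) x) sums (x * poly (B n) x)"
proof -
  have fin: "finite {m. J n m \<noteq> 0}"
    and X: "[:0, 1:] * B n = (\<Sum>m | J n m \<noteq> 0. smult (J n m) (B m))"
    using assms unfolding jacobi_matrix_def by auto
  have "x * poly (B n) x = (\<Sum>m | J n m \<noteq> 0. J n m * poly (B m) x)"
    using arg_cong[OF X, of "\<lambda>q. poly q x"] by (simp add: poly_sum)
  then show ?thesis using fin sums_finite[OF fin, of "\<lambda>m. J n m * poly (B m) x"] by simp
qed

section \<open>Positivity beyond the zeros\<close>

text \<open>A nonpositive value at \<open>x\<close>, together with a positive value further right,
  would produce a zero by the intermediate value theorem.\<close>

lemma pos_on_ray:
  fixes f :: "real \<Rightarrow> real"
  assumes cont: "continuous_on {b..} f" and ev: "eventually (\<lambda>x. f x > 0) at_top"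
    and nz: "\<And>x. x \<ge> b \<Longrightarrow> f x \<noteq> 0" and x: "x \<ge> b"
  shows "f x > 0"
proof (rule ccontr)
  assume "\<not> f x > 0"
  then have le: "f x \<le> 0" by simp
  obtain y where y: "y \<ge> x" "f y > 0"
    using ev unfolding eventually_at_top_linorder by (metis linear)
  have "\<exists>z. x \<le> z \<and> z \<le> y \<and> f z = 0"
    using y le x by (intro IVT') (auto intro: continuous_on_subset[OF cont])
  then show False using nz x by force
qed

lemma norm_le_zero_bound:
  assumes "zero_bound Z < \<infinity>" "z \<in> Z"
  shows "norm z \<le> enn2real (zero_bound Z)"
proof -
  have "ennreal (norm z) \<le> zero_bound Z"
    unfolding zero_bound_def by (rule SUP_upper[OF assms(2)])
  then show ?thesis
    using enn2real_mono[of "ennreal (norm z)" "zero_bound Z"] assms(1) by simp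
qed

text \<open>A real element of \<open>Z\<close> at or beyond the bound would have to equal the bound,
  which is excluded.\<close>

lemma beyond_zero_bound:
  assumes "zero_bound Z < \<infinity>" "complex_of_real (enn2real (zero_bound Z)) \<notin> Z"
    and "x \<ge> enn2real (zero_bound Z)"
  shows "complex_of_real x \<notin> Z"
proof
  assume "complex_of_real x \<in> Z"
  from norm_le_zero_bound[OF assms(1) this] assms(3) have "x = enn2real (zero_bound Z)" by simp
  with assms(2) \<open>complex_of_real x \<in> Z\<close> show False by simp
qed

lemma typeII_pos:
  assumes B: "typeII_mops M s p w nv B" and fin: "zero_bound (zeros_B B) < \<infinity>"
    and notin: "complex_of_real (enn2real (zero_bound (zeros_B B))) \<notin> zeros_B B"
    and x: "x \<ge> enn2real (zero_bound (zeros_B B))"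
  shows "poly (B n) x > 0"
proof (rule pos_on_ray[OF _ _ _ x])
  have "lead_coeff (B n) = 1" using B unfolding typeII_mops_def by blast
  then have "lead_coeff (B n) > 0" by simp
  \<comment> \<open>The eventual lower bound by the leading coefficient also covers the constant
    polynomial \<open>B 0\<close>.\<close>
  from poly_pinfty_gt_lc[OF this] obtain c where "\<forall>y\<ge>c. poly (B n) y \<ge> lead_coeff (B n)" by blast
  then show "eventually (\<lambda>y. poly (B n) y > 0) at_top"
    using \<open>lead_coeff (B n) > 0\<close> unfolding eventually_at_top_linorder
    by (intro exI[of _ c]) (auto intro: less_le_trans)
  fix y assume "y \<ge> enn2real (zero_bound (zeros_B B))"
  from beyond_zero_bound[OF fin notin this] show "poly (B n) y \<noteq> 0"
    by (auto simp: zeros_B_def poly_map_of_real)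
qed (intro continuous_intros)

text \<open>\<open>B\<^sup>(\<^sup>1\<^sup>)\<close> has a zero, and if the bound were \<open>0\<close> that zero would attain it.\<close>

lemma typeII_zero_bound_pos:
  assumes B: "typeII_mops M s p w nv B" and fin: "zero_bound (zeros_B B) < \<infinity>"
    and notin: "complex_of_real (enn2real (zero_bound (zeros_B B))) \<notin> zeros_B B"
  shows "enn2real (zero_bound (zeros_B B)) > 0"
proof -
  have "degree (B 1) = 1" "lead_coeff (B 1) = 1" using B unfolding typeII_mops_def by blast+
  then obtain c where c: "B 1 = [:c, 1:]"
    by (elim degree1_coeffs) auto
  have z: "complex_of_real (- c) \<in> zeros_B B"
    unfolding zeros_B_def
    by (rule UN_I[of 1]) (simp_all add: poly_map_of_real c del: of_real_minus One_nat_def)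
  from norm_le_zero_bound[OF fin z] have "enn2real (zero_bound (zeros_B B)) \<ge> \<bar>c\<bar>" by simp
  moreover have "c \<noteq> 0 \<or> enn2real (zero_bound (zeros_B B)) \<noteq> 0" using z notin by auto
  ultimately show ?thesis by linarith
qed

lemma rlinform_pos:
  assumes fin: "zero_bound (zeros_Q p w D A) < \<infinity>"
    and notin: "complex_of_real (enn2real (zero_bound (zeros_Q p w D A))) \<notin> zeros_Q p w D A"
    and D: "\<forall>x\<ge>enn2real (zero_bound (zeros_Q p w D A)). complex_of_real x \<in> D"
    and real: "\<forall>a\<in>{1..p}. \<forall>x\<ge>enn2real (zero_bound (zeros_Q p w D A)). w a (complex_of_real x) \<in> \<real>"
    and cont: "\<forall>a\<in>{1..p}. continuous_on {enn2real (zero_bound (zeros_Q p w D A))..} (rw w a)"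
    and lim: "filterlim (rlinform p w (A n)) at_top at_top"
    and x: "x \<ge> enn2real (zero_bound (zeros_Q p w D A))"
  shows "rlinform p w (A n) x > 0"
proof (rule pos_on_ray[OF _ _ _ x])
  show "continuous_on {enn2real (zero_bound (zeros_Q p w D A))..} (rlinform p w (A n))"
    unfolding rlinform_eq[abs_def] using cont by (intro continuous_intros) auto
  show "eventually (\<lambda>y. rlinform p w (A n) y > 0) at_top"
    using lim by (simp add: filterlim_at_top_dense)
  fix y assume y: "y \<ge> enn2real (zero_bound (zeros_Q p w D A))"
  \<comment> \<open>Being real, the value of the form cannot have vanishing real part without being
    zero itself.\<close>
  have "linform p w (A n) (complex_of_real y) \<in> \<real>"
    unfolding linform_def using real y by (intro sum_in_Reals Reals_mult) (auto simp: poly_map_of_real)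
  moreover have "linform p w (A n) (complex_of_real y) \<noteq> 0"
    using beyond_zero_bound[OF fin notin y] D y by (auto simp: zeros_Q_def)
  ultimately show "rlinform p w (A n) y \<noteq> 0"
    unfolding rlinform_def by (auto elim: Reals_cases)
qed

section \<open>Dual stochastic matrices\<close>

text \<open>This is the Doob transform of \<open>J\<close> by the positive right eigenvector
  \<open>b\<close>: the eigenvalue equation, divided by \<open>lam * b n\<close>, says that row
  \<open>n\<close> sums to 1.\<close>

lemma stochastic_diag_conj:
  assumes lam: "lam > 0" and b: "\<And>n. b n > 0" and J: "\<And>n m. J n m \<ge> 0"
    and ev: "\<And>n. (\<lambda>m. J n m * b m) sums (lam * b n)"
  shows "stochastic (\<lambda>n m. (1 / lam) * diag_conj (\<lambda>k. 1 / b k) J n m)"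
  unfolding stochastic_def
proof (intro conjI allI)
  fix n
  have "(\<lambda>m. (1 / (lam * b n)) * (J n m * b m)) sums ((1 / (lam * b n)) * (lam * b n))"
    by (rule sums_mult[OF ev])
  then show "(\<lambda>m. (1 / lam) * diag_conj (\<lambda>k. 1 / b k) J n m) sums 1"
    using lam b[of n] by (simp add: diag_conj_def field_simps)
  show "0 \<le> (1 / lam) * diag_conj (\<lambda>k. 1 / b k) J n m" for m
    using lam b J by (auto simp: diag_conj_def less_imp_le)
qed

text \<open>The factor \<open>b n\<close> cancels the left conjugating factor, and the eigenvalue
  equation for the transpose with eigenvector \<open>q\<close> remains. The two dual matrices use it
  with \<open>b\<close> and \<open>q\<close> exchanged.\<close>

lemma sums_diag_conj:
  assumes lam: "lam > 0" and b: "\<And>n. b n > 0"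
    and ev: "(\<lambda>n. J n m * q n) sums (lam * q m)"
  shows "(\<lambda>n. b n * q n * ((1 / lam) * diag_conj (\<lambda>k. 1 / b k) J n m)) sums (b m * q m)"
proof -
  have eq: "(\<lambda>n. b n * q n * ((1 / lam) * diag_conj (\<lambda>k. 1 / b k) J n m)) =
      (\<lambda>n. (b m / lam) * (J n m * q n))"
  proof
    fix n show "b n * q n * ((1 / lam) * diag_conj (\<lambda>k. 1 / b k) J n m) = (b m / lam) * (J n m * q n)"
      using b[of n] by (simp add: diag_conj_def)
  qed
  have "(\<lambda>n. (b m / lam) * (J n m * q n)) sums ((b m / lam) * (lam * q m))"
    by (rule sums_mult[OF ev])
  then show ?thesis unfolding eq using lam by simp
qed

lemma steady_state_normalized:
  assumes pos: "\<And>n. v n > 0" and sm: "summable v"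
    and st: "\<And>m. (\<lambda>n. v n * P n m) sums v m"
  shows "steady_state (normalized v) P" and "normalized v n > 0"
proof -
  have n: "normalized v = (\<lambda>n. v n / suminf v)"
    using pos by (simp add: normalized_def fun_eq_iff less_imp_le)
  have S: "suminf v > 0" by (rule suminf_pos[OF sm pos])
  show "normalized v n > 0" using S pos by (simp add: n)
  have "(\<lambda>n. v n / suminf v) sums (suminf v / suminf v)"
    by (rule sums_divide[OF summable_sums[OF sm]])
  moreover have "(\<lambda>n. v n / suminf v * P n m) sums (v m / suminf v)" for m
    using sums_divide[OF st[of m], of "suminf v"] by (simp add: field_simps)
  ultimately show "steady_state (normalized v) P"
    using S pos by (simp add: steady_state_def n less_imp_le)
qed

theorem theorem5:
  fixes \<Delta> :: "real set" and M :: "real measure" and s :: real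
    and p :: nat and w :: "nat \<Rightarrow> complex \<Rightarrow> complex" and D :: "complex set"
    and nv :: "nat \<Rightarrow> nat"
    and B :: "nat \<Rightarrow> real poly" and A :: "nat \<Rightarrow> nat \<Rightarrow> real poly"
    and J :: "nat \<Rightarrow> nat \<Rightarrow> real" and lam :: real
  assumes "measure_on \<Delta> M s"
    and "p \<ge> 1" and "\<forall>a\<in>{1..p}. nv a > 0"
    and "weights_on \<Delta> M p w D"
    and "perfect M s p w"
    and "typeII_mops M s p w nv B"
    and "typeI_mops M s p w nv A"
    and "jacobi_matrix B J"
    and "\<forall>n m. J n m \<ge> 0"
    and "zero_bound (zeros_B B) < \<infinity>"
    and "complex_of_real (enn2real (zero_bound (zeros_B B))) \<notin> zeros_B B"
    and "zero_bound (zeros_Q p w D A) < \<infinity>"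
    and "complex_of_real (enn2real (zero_bound (zeros_Q p w D A))) \<notin> zeros_Q p w D A"
    and "\<forall>x\<ge>enn2real (zero_bound (zeros_Q p w D A)). complex_of_real x \<in> D"
    and "\<forall>a\<in>{1..p}. \<forall>x\<ge>enn2real (zero_bound (zeros_Q p w D A)). w a (complex_of_real x) \<in> \<real>"
    and "\<forall>a\<in>{1..p}. continuous_on {enn2real (zero_bound (zeros_Q p w D A))..} (rw w a)"
    and "\<forall>n. filterlim (rlinform p w (A n)) at_top at_top"
    and "lam \<ge> max (enn2real (zero_bound (zeros_B B))) (enn2real (zero_bound (zeros_Q p w D A)))"
  shows
    "stochastic (P_II B J lam) \<and> stochastic (P_I p w A J lam) \<and>
     (\<forall>n. 0 \<le> kappa p w A B lam n) \<and>
     left_eigenvector (kappa p w A B lam) (P_II B J lam) 1 \<and>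
     left_eigenvector (kappa p w A B lam) (P_I p w A J lam) 1 \<and>
     (summable (\<lambda>n. \<bar>kappa p w A B lam n\<bar>) \<longrightarrow>
       (\<forall>P \<in> {P_II B J lam, P_I p w A J lam}.
          steady_state (normalized (kappa p w A B lam)) P \<and>
          positive_recurrent P \<and> (aperiodic P \<longrightarrow> ergodic P))) \<and>
     ((\<exists>L<1. (\<lambda>n. kappa p w A B lam (n + 1) / kappa p w A B lam n) \<longlonglongrightarrow> L) \<longrightarrow>
       summable (\<lambda>n. \<bar>kappa p w A B lam n\<bar>) \<and>
       (\<forall>P \<in> {P_II B J lam, P_I p w A J lam}.
          steady_state (normalized (kappa p w A B lam)) P))"
proof -
  let ?b = "\<lambda>n. poly (B n) lam" and ?q = "\<lambda>n. rlinform p w (A n) lam"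
  let ?v = "kappa p w A B lam"
  have v: "?v = (\<lambda>n. ?b n * ?q n)" by (simp add: kappa_def fun_eq_iff)
  have PII: "P_II B J lam = (\<lambda>n m. (1 / lam) * diag_conj (\<lambda>k. 1 / ?b k) J n m)"
    by (simp add: P_II_def fun_eq_iff)
  have PI: "P_I p w A J lam = (\<lambda>n m. (1 / lam) * diag_conj (\<lambda>k. 1 / ?q k) (\<lambda>i j. J j i) n m)"
    by (simp add: P_I_def fun_eq_iff)
  \<comment> \<open>Already the bound for the zeros of the \<open>B n\<close> is strictly
    positive.\<close>
  have lam: "lam > 0"
    using typeII_zero_bound_pos[OF assms(6,10,11)] assms(18) by linarith
  have b: "?b n > 0" for n
    using typeII_pos[OF assms(6,10,11), of lam n] assms(18) by simp
  have q: "?q n > 0" for n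
    using rlinform_pos[OF assms(12-16) spec[OF assms(17), of n], of lam] assms(18) by simp
  have J: "J n m \<ge> 0" for n m using assms(9) by blast
  have Jb: "(\<lambda>m. J n m * ?b m) sums (lam * ?b n)" for n
    by (rule jacobi_poly[OF assms(8)])
  have Jq: "(\<lambda>m. J m n * ?q m) sums (lam * ?q n)" for n
    by (rule jacobi_transpose_rlinform[OF assms(2,3,4,6,7,8)])
  have S: "stochastic (P_II B J lam)" "stochastic (P_I p w A J lam)"
    unfolding PII PI
    by (rule stochastic_diag_conj[where b = ?b, OF lam b J Jb],
        rule stochastic_diag_conj[where b = ?q, OF lam q J Jq])
  have st_II: "(\<lambda>n. ?v n * P_II B J lam n m) sums ?v m" for m
    unfolding v PII by (rule sums_diag_conj[where b = ?b and q = ?q, OF lam b Jq])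
  \<comment> \<open>The factors are swapped so that \<open>sums_diag_conj\<close> applies to the
    transpose, where \<open>?q\<close> is the conjugating vector.\<close>
  have v': "?v = (\<lambda>n. ?q n * ?b n)" by (simp add: kappa_def fun_eq_iff)
  have st_I: "(\<lambda>n. ?v n * P_I p w A J lam n m) sums ?v m" for m
    unfolding v' PI by (rule sums_diag_conj[where b = ?q and q = ?b, OF lam q Jb])
  have pos: "?v n > 0" for n using b q by (simp add: v)
  have abs: "(\<lambda>n. \<bar>?v n\<bar>) = ?v" using pos by (simp add: fun_eq_iff less_imp_le)
  have steady: "steady_state (normalized ?v) P \<and> positive_recurrent P"
    if sm: "summable ?v" and P: "P \<in> {P_II B J lam, P_I p w A J lam}" for P
  proof -
    have 1: "(\<lambda>n. ?v n * P n m) sums ?v m" for m using P st_II st_I by auto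
    have 2: "stochastic P" using P S by auto
    note ss = steady_state_normalized[OF pos sm 1]
    show ?thesis using ss(1) steady_state_imp_positive_recurrent[OF 2 ss] by blast
  qed
  have ratio: "summable ?v" if L: "L < 1" "(\<lambda>n. ?v (n + 1) / ?v n) \<longlonglongrightarrow> L" for L
  proof -
    \<comment> \<open>The ratio test needs a constant below 1 that eventually bounds the ratios; the
      limit \<open>L\<close> itself need not bound them.\<close>
    obtain c where c: "L < c" "c < 1" using dense[OF L(1)] by blast
    have "eventually (\<lambda>n. ?v (n + 1) / ?v n < c) sequentially"
      by (rule order_tendstoD(2)[OF L(2) c(1)])
    then obtain N where N: "\<forall>n\<ge>N. ?v (n + 1) / ?v n < c"
      unfolding eventually_sequentially by blast
    show ?thesis
    proof (rule summable_ratio_test[OF c(2), of N])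
      fix n assume "N \<le> n"
      with N have "?v (n + 1) / ?v n < c" by blast
      then have "?v (Suc n) < c * ?v n" using pos[of n] by (simp add: divide_less_eq)
      then show "norm (?v (Suc n)) \<le> c * norm (?v n)"
        using pos[of n] pos[of "Suc n"] by simp
    qed
  qed
  have nz: "\<exists>n. ?v n \<noteq> 0" using pos[of 0] by (intro exI[of _ 0]) simp
  have nn: "0 \<le> ?v n" for n using pos[of n] by simp
  have left: "left_eigenvector ?v (P_II B J lam) 1" "left_eigenvector ?v (P_I p w A J lam) 1"
    unfolding left_eigenvector_def using nz st_II st_I by simp_all
  show ?thesis
    unfolding abs
  proof (intro conjI S left impI ballI allI nn)
    fix P assume *: "summable ?v" "P \<in> {P_II B J lam, P_I p w A J lam}"
    show "steady_state (normalized ?v) P" "positive_recurrent P"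
      using steady[OF *] by auto
    show "ergodic P" if "aperiodic P"
      using steady[OF *] that by (simp add: ergodic_def)
  next
    assume "\<exists>L<1. (\<lambda>n. ?v (n + 1) / ?v n) \<longlonglongrightarrow> L"
    then show sm: "summable ?v" using ratio by blast
    show "steady_state (normalized ?v) P" if "P \<in> {P_II B J lam, P_I p w A J lam}" for P
      using steady[OF sm that] by blast
  qed
qed

end
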